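(* Let $p\ge5$, $A$ a finite étale cubic $\mathbb Z_p$-algebra, $\overline A=A/pA$, $\eta\in A^\times$, $\gamma\in A$, $P$ the order of $\bar\eta\in\overline A^\times$, $\eta^P=1+pU$, $\omega=\bar U$, and assume $1,\omega,\omega^2$ is an $\mathbb F_p$-basis of $\overline A$. For $a\in\{0,\dots,P-1\}$ put $x_a=\bar\gamma\bar\eta^a$, $T_a=\operatorname{Tr}_A(\gamma\eta^a)$, $F_a(t)=\operatorname{Tr}_A(\gamma\eta^a(\eta^P)^t)$. Suppose $a$ is primitive first-order singular: $x_a\ne0$, $\operatorname{Tr}(x_a)=0$, $\operatorname{Tr}(x_a\omega)=0$ (traces of $\overline A/\mathbb F_p$). Then $\Delta_a:=\operatorname{Tr}(x_a\omega^2)\ne0$. If $T_a/p\not\equiv0\pmod p$, the class has no solution of $F_a(t)\equiv0\pmod{p^2}$. If $T_a/p\equiv0\pmod p$, define $A_a\equiv T_a/p^2$, $B_a\equiv\operatorname{Tr}_A(\gamma\eta^aU)/p\pmod p$ and $Q_a(X)=A_a+B_aX+\binom X2\Delta_a\in\mathbb F_p[X]$. Then $F_a(t)/p^2\equiv Q_a(t)\pmod p$ for $t\in\mathbb Z_p$; for $\rho\in\mathbb F_p$ with least representative $\tilde\rho\in\{0,\dots,p-1\}$, all $t\in\tilde\rho+p\mathbb Z_p$ satisfy $F_a(t)\equiv0\pmod{p^3}$ iff $Q_a(\rho)=0$. If $r$ is a simple root of $Q_a$ with least representative $\tilde r$, there is a unique $\tau_{a,r}\in\tilde r+p\mathbb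 Z_p$ with $F_a(\tau_{a,r})=0$ and $v_p(F_a(t))=2+v_p(t-\tau_{a,r})$ for $t\in\tilde r+p\mathbb Z_p$. If $r$ is a double root, then $H_{a,r}(Y)=F_a(\tilde r+Y)/p^2\in\mathbb Z_p\langle Y\rangle$, and there are a unique distinguished quadratic $W_{a,r}(Y)=Y^2+b_{a,r}Y+c_{a,r}$ with $b_{a,r},c_{a,r}\in p\mathbb Z_p$ and a unit $V_{a,r}\in\mathbb Z_p\langle Y\rangle^\times$ with $H_{a,r}=W_{a,r}V_{a,r}$; roots of $W_{a,r}$ in $\mathbb Q_p$ lie in $p\mathbb Z_p$ and correspond to zeros of $F_a$ in $\tilde r+p\mathbb Z_p$; with $\delta_{a,r}=b_{a,r}^2-4c_{a,r}$, this disk contains no zero, one double zero, or two simple zeros according as $\delta_{a,r}$ is a nonsquare in $\mathbb Q_p$, zero, or a nonzero square in $\mathbb Q_p$; and for every $k\ge3$ the classes in this disk with $F_a(t)\equiv0\pmod{p^k}$ are exactly $t=\tilde r+Y$ with $Y\in p\mathbb Z_p$ and $W_{a,r}(Y)\equiv0\pmod{p^{k-2}}$.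
   Context: $(\eta^P)^t$ for $t\in\mathbb Z_p$ is the convergent binomial series $\sum_m\binom tm(\eta^P-1)^m$, so $F_a$ is a restricted $p$-adic power series. A distinguished polynomial is monic with all non-leading coefficients in $p\mathbb Z_p$. $v_p(0)=+\infty$. *)

theory Defs
  imports
    "Berlekamp_Zassenhaus.Finite_Field"
    "HOL-Computational_Algebra.Computational_Algebra"
    "HOL-Library.Extended_Nat"
    "HOL-Library.Poly_Mapping"
begin

section \<open>The ring of p-adic integers\<close>

text \<open>
  The prime \<open>p\<close> is \<open>CARD('p)\<close> for a type \<open>'p\<close> of class \<^class>\<open>prime_card\<close>, so that the residue
  field is \<^typ>\<open>'p mod_ring\<close>. A p-adic integer is a compatible sequence of residues
  modulo \<open>p ^ n\<close>, each given by its least nonnegative representative.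
\<close>

typedef (overloaded) ('p :: prime_card) padic_int =
  "{f :: nat \<Rightarrow> int. \<forall>n. 0 \<le> f n \<and> f n < int CARD('p) ^ n \<and>
      f (Suc n) mod int CARD('p) ^ n = f n}"
  morphisms padic_nth Abs_padic_int
  by (rule exI[of _ "\<lambda>_. 0"]) (simp add: prime_gt_0_nat[OF prime_card])

setup_lifting type_definition_padic_int

lemma CARD_pos_int: "0 < int CARD('p :: prime_card) ^ n"
  using prime_gt_0_nat[OF prime_card, where 'a1 = 'p] by simp

lemma mod_mod_power_Suc: "(a mod int q ^ Suc n) mod int q ^ n = a mod int q ^ n"
  by (simp add: mod_mod_cancel)

lemma padic_compat_mod:
  assumes "\<And>n. h (Suc n) mod int CARD('p :: prime_card) ^ n = h n mod int CARD('p) ^ n"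
  shows "0 \<le> h n mod int CARD('p) ^ n \<and> h n mod int CARD('p) ^ n < int CARD('p) ^ n \<and>
    (h (Suc n) mod int CARD('p) ^ Suc n) mod int CARD('p) ^ n = h n mod int CARD('p) ^ n"
  using CARD_pos_int[of n, where 'p = 'p] assms[of n] mod_mod_power_Suc[of "h (Suc n)" "CARD('p)" n]
  by (simp del: power_Suc)

instantiation padic_int :: (prime_card) comm_ring_1
begin

lift_definition zero_padic_int :: "'a padic_int" is "\<lambda>_. 0"
  by (simp add: prime_gt_0_nat[OF prime_card])

lift_definition one_padic_int :: "'a padic_int" is "\<lambda>n. 1 mod int CARD('a) ^ n"
  by (rule padic_compat_mod) simp

lift_definition plus_padic_int :: "'a padic_int \<Rightarrow> 'a padic_int \<Rightarrow> 'a padic_int"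
  is "\<lambda>f g n. (f n + g n) mod int CARD('a) ^ n"
  by (rule padic_compat_mod) (metis mod_add_eq mod_mod_trivial)

lift_definition uminus_padic_int :: "'a padic_int \<Rightarrow> 'a padic_int"
  is "\<lambda>f n. (- f n) mod int CARD('a) ^ n"
  by (rule padic_compat_mod) (metis mod_minus_eq mod_mod_trivial)

lift_definition minus_padic_int :: "'a padic_int \<Rightarrow> 'a padic_int \<Rightarrow> 'a padic_int"
  is "\<lambda>f g n. (f n - g n) mod int CARD('a) ^ n"
  by (rule padic_compat_mod) (metis mod_diff_eq mod_mod_trivial)

lift_definition times_padic_int :: "'a padic_int \<Rightarrow> 'a padic_int \<Rightarrow> 'a padic_int"
  is "\<lambda>f g n. (f n * g n) mod int CARD('a) ^ n"
  by (rule padic_compat_mod) (metis mod_mult_eq mod_mod_trivial)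

instance
proof
  fix a b c :: "'a padic_int"
  show "a * b * c = a * (b * c)"
    by transfer (simp add: mod_simps mult.assoc)
  show "a * b = b * a"
    by transfer (simp add: mult.commute)
  show "1 * a = a"
    by transfer (auto simp: mod_simps intro!: ext)
  show "a + b + c = a + (b + c)"
    by transfer (simp add: mod_simps add.assoc)
  show "a + b = b + a"
    by transfer (simp add: add.commute)
  show "0 + a = a"
    by transfer (auto intro!: ext)
  show "- a + a = 0"
    by transfer (simp add: mod_simps)
  show "a - b = a + - b"
    by transfer (simp add: mod_simps)
  show "(a + b) * c = a * c + b * c"
    by transfer (simp add: mod_simps distrib_right)
  show "(0 :: 'a padic_int) \<noteq> 1"
  proof (transfer, rule notI)
    assume "(\<lambda>_. 0) = (\<lambda>n. 1 mod int CARD('a) ^ n)"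
    from fun_cong[OF this, of 1] show False
      using prime_gt_1_nat[OF prime_card, where 'a1 = 'a] by simp
  qed
qed

end

lemma padic_nth_range: "0 \<le> padic_nth (x :: 'p :: prime_card padic_int) n"
    "padic_nth x n < int CARD('p) ^ n"
  using padic_nth[of x] by auto

lemma padic_nth_mod:
  "padic_nth (x :: 'p :: prime_card padic_int) (n + k) mod int CARD('p) ^ n = padic_nth x n"
proof (induction k)
  case 0
  then show ?case using padic_nth_range[of x n] by simp
next
  case (Suc k)
  have "padic_nth x (n + k) = padic_nth x (Suc (n + k)) mod int CARD('p) ^ (n + k)"
    using padic_nth[of x] by simp
  with Suc show ?case
    by (simp add: mod_mod_cancel le_imp_power_dvd)
qed

lemma padic_nth_of_nat:
  "padic_nth (of_nat m :: 'p :: prime_card padic_int) n = int m mod int CARD('p) ^ n"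
  by (induction m)
    (simp_all add: zero_padic_int.rep_eq one_padic_int.rep_eq plus_padic_int.rep_eq mod_simps)

lemma prime_power_dvd_mult_split:
  fixes q a b :: int
  assumes "prime q" "q ^ (m + n) dvd a * b"
  shows "q ^ m dvd a \<or> q ^ n dvd b"
proof (cases "a = 0 \<or> b = 0")
  case False
  have q: "prime_elem q" "\<not> is_unit q"
    using assms(1) by auto
  have "m + n \<le> multiplicity q a + multiplicity q b"
    using False assms q
    by (metis mult_eq_0_iff power_dvd_iff_le_multiplicity prime_elem_multiplicity_mult_distrib)
  then show ?thesis
    using False q by (metis add_le_mono linorder_not_le not_less_eq_eq multiplicity_dvd' nat_le_linear
        add_less_mono)
qed auto

instance padic_int :: (prime_card) idom
proof
  fix x y :: "'a padic_int"
  assume "x \<noteq> 0" "y \<noteq> 0"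
  then obtain m n where m: "padic_nth x m \<noteq> 0" and n: "padic_nth y n \<noteq> 0"
    by (metis padic_nth_inject zero_padic_int.rep_eq ext)
  show "x * y \<noteq> 0"
  proof
    assume "x * y = 0"
    then have "int CARD('a) ^ (m + n) dvd padic_nth x (m + n) * padic_nth y (m + n)"
      by (metis mod_0_imp_dvd times_padic_int.rep_eq zero_padic_int.rep_eq)
    with prime_card_int[where 'a = 'a]
    have "int CARD('a) ^ m dvd padic_nth x (m + n) \<or> int CARD('a) ^ n dvd padic_nth y (m + n)"
      by (rule prime_power_dvd_mult_split)
    then show False
      using m n padic_nth_mod[of x m n] padic_nth_mod[of y n m] by (auto simp: add.commute)
  qed
qed

instance padic_int :: (prime_card) ring_char_0
proof
  show "inj (of_nat :: nat \<Rightarrow> 'a padic_int)"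
  proof (rule injI)
    fix k m :: nat
    assume eq: "(of_nat k :: 'a padic_int) = of_nat m"
    define N where "N = k + m"
    have "N < CARD('a) ^ N"
      using prime_gt_1_nat[OF prime_card, where 'a1 = 'a] by (simp add: power_gt_expt)
    then have "int k < int CARD('a) ^ N" "int m < int CARD('a) ^ N"
      unfolding N_def by (simp_all flip: of_nat_power)
    moreover have "int k mod int CARD('a) ^ N = int m mod int CARD('a) ^ N"
      using eq by (metis padic_nth_of_nat)
    ultimately show "k = m" by simp
  qed
qed

text \<open>Exact division; the value is meaningful only if \<open>y dvd x\<close>.\<close>

instantiation padic_int :: (prime_card) idom_divide
begin

definition divide_padic_int :: "'a padic_int \<Rightarrow> 'a padic_int \<Rightarrow> 'a padic_int" where
  "divide_padic_int x y = (if y \<noteq> 0 \<and> y dvd x then THE z. x = z * y else 0)"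

instance
  by standard (auto simp: divide_padic_int_def)

end

definition padic_val :: "'p :: prime_card padic_int \<Rightarrow> enat" where
  "padic_val x = (if x = 0 then \<infinity> else enat (GREATEST n. of_nat CARD('p) ^ n dvd x))"

definition padic_red :: "'p :: prime_card padic_int \<Rightarrow> 'p mod_ring" where
  "padic_red x = of_int_mod_ring (padic_nth x 1)"

text \<open>The least representative in \<open>{0..p-1}\<close> of an element of the residue field.\<close>

definition least_rep :: "'p :: prime_card mod_ring \<Rightarrow> 'p padic_int" where
  "least_rep r = of_int (to_int_mod_ring r)"

definition residue_disk :: "'p :: prime_card mod_ring \<Rightarrow> 'p padic_int set" where
  "residue_disk r = {least_rep r + of_nat CARD('p) * y | y. True}"


section \<open>Adically convergent series\<close>

definition adic_sums :: "'a :: comm_ring_1 \<Rightarrow> (nat \<Rightarrow> 'a) \<Rightarrow> 'a \<Rightarrow> bool" where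
  "adic_sums q f s \<longleftrightarrow> (\<forall>k. \<forall>\<^sub>F n in sequentially. q ^ k dvd (\<Sum>i<n. f i) - s)"

definition adic_suminf :: "'a :: comm_ring_1 \<Rightarrow> (nat \<Rightarrow> 'a) \<Rightarrow> 'a" where
  "adic_suminf q f = (THE s. adic_sums q f s)"

text \<open>The division is exact. (The library constrains \<open>(gchoose)\<close> to fields.)\<close>

definition padic_binom :: "'p :: prime_card padic_int \<Rightarrow> nat \<Rightarrow> 'p padic_int" where
  "padic_binom t m = (\<Prod>i<m. t - of_nat i) div fact m"

text \<open>The power \<open>u ^ t\<close> with p-adic exponent, for \<open>u\<close> congruent to 1 modulo \<open>p\<close> in an algebra
  with structure map \<open>\<iota>\<close>.\<close>

definition adic_pow :: "('p :: prime_card padic_int \<Rightarrow> 'a :: comm_ring_1) \<Rightarrow> 'a \<Rightarrow> 'p padic_int \<Rightarrow> 'a"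
  where "adic_pow \<iota> u t = adic_suminf (of_nat CARD('p)) (\<lambda>m. \<iota> (padic_binom t m) * (u - 1) ^ m)"

definition restricted :: "'p :: prime_card padic_int fps \<Rightarrow> bool" where
  "restricted f \<longleftrightarrow> (\<forall>k. \<forall>\<^sub>F n in sequentially. of_nat CARD('p) ^ k dvd fps_nth f n)"

definition restricted_unit :: "'p :: prime_card padic_int fps \<Rightarrow> bool" where
  "restricted_unit f \<longleftrightarrow> restricted f \<and> (\<exists>g. restricted g \<and> f * g = 1)"

definition restricted_eval :: "'p :: prime_card padic_int fps \<Rightarrow> 'p padic_int \<Rightarrow> 'p padic_int" where
  "restricted_eval f y = adic_suminf (of_nat CARD('p)) (\<lambda>n. fps_nth f n * y ^ n)"

text \<open>\<open>\<tau>\<close> is a zero of multiplicity \<open>m\<close> (an element of \<open>\<int>\<^sub>p\<close> that is no zero has multiplicity 0)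
  of a function that is given around \<open>\<tau>\<close> by a restricted power series. A restricted series is
  determined by its values on \<open>\<int>\<^sub>p\<close>.\<close>

definition zero_of_mult ::
    "('p :: prime_card padic_int \<Rightarrow> 'p padic_int) \<Rightarrow> 'p padic_int \<Rightarrow> nat \<Rightarrow> bool" where
  "zero_of_mult F \<tau> m \<longleftrightarrow> (\<exists>g. restricted g \<and> (\<forall>y. F (\<tau> + y) = restricted_eval g y) \<and>
     g \<noteq> 0 \<and> subdegree g = m)"

definition distinguished :: "'p :: prime_card padic_int poly \<Rightarrow> bool" where
  "distinguished W \<longleftrightarrow> lead_coeff W = 1 \<and> (\<forall>i<degree W. of_nat CARD('p) dvd coeff W i)"


section \<open>Finite free algebras, trace, finite etale algebras\<close>

definition is_alg_basis :: "('r :: comm_ring_1 \<Rightarrow> 'a :: comm_ring) \<Rightarrow> nat \<Rightarrow> (nat \<Rightarrow> 'a) \<Rightarrow> bool" where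
  "is_alg_basis \<iota> n b \<longleftrightarrow>
     (\<forall>x. \<exists>!c. c \<in> {..<n} \<rightarrow>\<^sub>E UNIV \<and> x = (\<Sum>i<n. \<iota> (c i) * b i))"

definition alg_coords ::
    "('r :: comm_ring_1 \<Rightarrow> 'a :: comm_ring) \<Rightarrow> nat \<Rightarrow> (nat \<Rightarrow> 'a) \<Rightarrow> 'a \<Rightarrow> nat \<Rightarrow> 'r" where
  "alg_coords \<iota> n b x = (THE c. c \<in> {..<n} \<rightarrow>\<^sub>E UNIV \<and> x = (\<Sum>i<n. \<iota> (c i) * b i))"

text \<open>The trace of multiplication by \<open>x\<close> on an algebra that is free of rank \<open>n\<close>; it does not
  depend on the basis.\<close>

definition alg_trace :: "('r :: comm_ring_1 \<Rightarrow> 'a :: comm_ring) \<Rightarrow> nat \<Rightarrow> 'a \<Rightarrow> 'r" where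
  "alg_trace \<iota> n x =
     (let b = (SOME b. is_alg_basis \<iota> n b) in \<Sum>i<n. alg_coords \<iota> n b (x * b i) i)"

text \<open>The module of Kaehler differentials is the free module on the symbols \<open>d a\<close> modulo the
  following submodule of relations.\<close>

abbreviation dsym :: "'a :: comm_ring_1 \<Rightarrow> 'a \<Rightarrow>\<^sub>0 'a" where
  "dsym a \<equiv> Poly_Mapping.single a 1"

inductive_set kaehler_relations :: "('r :: comm_ring_1 \<Rightarrow> 'a :: comm_ring_1) \<Rightarrow> ('a \<Rightarrow>\<^sub>0 'a) set"
  for \<iota> :: "'r \<Rightarrow> 'a" where
  zero: "0 \<in> kaehler_relations \<iota>"
| add: "w \<in> kaehler_relations \<iota> \<Longrightarrow> z \<in> kaehler_relations \<iota> \<Longrightarrow> w + z \<in> kaehler_relations \<iota>"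
| scale: "w \<in> kaehler_relations \<iota> \<Longrightarrow> Poly_Mapping.map ((*) c) w \<in> kaehler_relations \<iota>"
| d_add: "dsym (a + b) - dsym a - dsym b \<in> kaehler_relations \<iota>"
| d_mult: "dsym (a * b) - Poly_Mapping.single b a - Poly_Mapping.single a b \<in> kaehler_relations \<iota>"
| d_const: "dsym (\<iota> r) \<in> kaehler_relations \<iota>"

text \<open>Finite etale means finite, flat and unramified, the latter being the vanishing of the
  differentials. Over the local ring \<open>\<int>\<^sub>p\<close>, finite flat of rank \<open>n\<close> means free of rank \<open>n\<close>.\<close>

definition finite_etale :: "nat \<Rightarrow> ('p :: prime_card padic_int \<Rightarrow> 'a :: comm_ring_1) \<Rightarrow> bool" where
  "finite_etale n \<iota> \<longleftrightarrow>
     comm_ring_hom \<iota> \<and> (\<exists>b. is_alg_basis \<iota> n b) \<and> kaehler_relations \<iota> = UNIV"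


section \<open>The reduction of an algebra modulo p\<close>

quotient_type (overloaded) ('a, 'p) mod_p =
    "'a :: comm_ring_1" / "\<lambda>x y. of_nat CARD('p :: prime_card) dvd x - y"
  morphisms rep_mod_p to_mod_p
proof (rule equivpI)
  show "reflp (\<lambda>x y :: 'a. of_nat CARD('p) dvd x - y)"
    by (rule reflpI) simp
  show "symp (\<lambda>x y :: 'a. of_nat CARD('p) dvd x - y)"
    by (rule sympI) (metis dvd_minus_iff minus_diff_eq)
  show "transp (\<lambda>x y :: 'a. of_nat CARD('p) dvd x - y)"
    by (rule transpI) (metis diff_add_cancel add_diff_eq dvd_add)
qed

text \<open>No \<^class>\<open>comm_ring_1\<close> instance, as the quotient may be the zero ring.\<close>

instantiation mod_p :: (comm_ring_1, prime_card) "{comm_ring, comm_monoid_mult}"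
begin

lift_definition zero_mod_p :: "('a, 'b) mod_p" is 0 .

lift_definition one_mod_p :: "('a, 'b) mod_p" is 1 .

lift_definition plus_mod_p :: "('a, 'b) mod_p \<Rightarrow> ('a, 'b) mod_p \<Rightarrow> ('a, 'b) mod_p" is "(+)"
  by (metis add_diff_add dvd_add)

lift_definition uminus_mod_p :: "('a, 'b) mod_p \<Rightarrow> ('a, 'b) mod_p" is uminus
  by (metis dvd_minus_iff minus_diff_minus)

lift_definition minus_mod_p :: "('a, 'b) mod_p \<Rightarrow> ('a, 'b) mod_p \<Rightarrow> ('a, 'b) mod_p" is "(-)"
  by (metis dvd_diff diff_diff_eq2 add_diff_eq diff_add_eq diff_diff_add)

lift_definition times_mod_p :: "('a, 'b) mod_p \<Rightarrow> ('a, 'b) mod_p \<Rightarrow> ('a, 'b) mod_p" is "(*)"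
  by (metis mult_diff_mult dvd_add dvd_mult dvd_mult2)

instance
  by standard (transfer; simp add: algebra_simps)+

end

text \<open>The \<open>\<bbbF>\<^sub>p\<close>-algebra structure of \<open>A / pA\<close>.\<close>

definition mod_p_scalar :: "'p :: prime_card mod_ring \<Rightarrow> ('a :: comm_ring_1, 'p) mod_p" where
  "mod_p_scalar c = to_mod_p (of_int (to_int_mod_ring c))"

definition mult_order :: "'a :: monoid_mult \<Rightarrow> nat" where
  "mult_order x = (LEAST n. 0 < n \<and> x ^ n = 1)"

end

theory Submission
  imports Defs
begin

text \<open>
  Write \<open>\<tau>\<^sub>m = Tr(\<gamma> \<eta>\<^sup>a U\<^sup>m)\<close>. Then \<open>F(t) = \<Sum>\<^sub>m \<tau>\<^sub>m (p\<^sup>m / m!) t(t - 1)\<cdots>(t - m + 1)\<close>, and for \<open>p \<ge> 5\<close> the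
  factor \<open>p\<^sup>m / m!\<close> tends to 0 and is divisible by \<open>p\<^sup>3\<close> for \<open>m \<ge> 3\<close>. Hence around every centre \<open>s\<close>
  the function \<open>F\<close> is a restricted power series that modulo \<open>p\<^sup>3\<close> is given by its terms \<open>m \<le> 2\<close>;
  when \<open>p\<^sup>2\<close> divides \<open>T\<close>, dividing by \<open>p\<^sup>2\<close> leaves a series \<open>H\<close> whose reduction is the Taylor expansion
  of \<open>Q\<close>. Simple roots lift by Hensel's contraction, double roots by Weierstrass preparation.

  The vanishing of the first two traces makes \<open>\<Delta> = 0\<close> equivalent to \<open>x\<close> being orthogonal to
  \<open>1, \<omega>, \<omega>\<^sup>2\<close>, which is excluded because the trace form of an unramified algebra is nondegenerate.
\<close>

section \<open>Adically complete rings\<close>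

text \<open>All work stays integral: division by \<open>m!\<close>, by \<open>p ^ 2\<close> and by 2
  is shown to be exact or replaced by multiplication with a unit, and fractions enter only for the
  roots of \<open>W\<close> and the square root of its discriminant. The origin of p \<ge> 5 is the
  strict bound 4 v(m!) < m for m > 0. It gives v(p^m / m!) > 3m/4, and integrality turns the value
  above 9/4 at m = 3 into 3. For p = 3 that term only has valuation 2 and could enter the reduction.
  The obstacle with restricted series is that limits live in the ring of all formal power series.
  Completeness is therefore proved there, and restrictedness is carried through the contraction
  argument as a closed condition. Multiplicity refers to an expansion at the zero itself. Hence F is
  expanded around every centre, and an identity principle (a restricted series vanishing at all
  points of Z_p is 0) makes the expansions canonical. Nondegeneracy avoids splitting the reduced
  algebra into fields: a map that is a derivation only modulo f'(\<omega>) is fed directly into the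
  relations among differentials.\<close>

definition adic_separated :: "'a :: comm_ring_1 \<Rightarrow> bool" where
  "adic_separated q \<longleftrightarrow> (\<forall>x. (\<forall>k. q ^ k dvd x) \<longrightarrow> x = 0)"

text \<open>Cauchy sequences are normalised: \<open>f k\<close> is thought of as known modulo
  \<open>q ^ k\<close>, and the limit must agree with it to that precision. This keeps rates
  explicit.\<close>

definition adic_complete :: "'a :: comm_ring_1 \<Rightarrow> bool" where
  "adic_complete q \<longleftrightarrow> adic_separated q \<and>
     (\<forall>f. (\<forall>k. q ^ k dvd f (Suc k) - f k) \<longrightarrow> (\<exists>l. \<forall>k. q ^ k dvd l - f k))"

lemma dvd_diff_trans:
  fixes a b c d :: "'a :: comm_ring_1"
  assumes "d dvd a - b" "d dvd b - c"
  shows "d dvd a - c"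
  using dvd_add[OF assms] by simp

lemma dvd_diff_sym: "d dvd a - b \<longleftrightarrow> d dvd b - (a :: 'a :: comm_ring_1)"
  by (metis dvd_minus_iff minus_diff_eq)

lemma dvd_diff_left_common:
  fixes a b c d :: "'a :: comm_ring_1"
  assumes "d dvd a - b" "d dvd a - c"
  shows "d dvd b - c"
  using dvd_diff[OF assms(2,1)] by simp

lemma dvd_diff_right_common:
  fixes a b c d :: "'a :: comm_ring_1"
  assumes "d dvd a - c" "d dvd b - c"
  shows "d dvd a - b"
  using dvd_diff[OF assms] by simp

lemma adic_separatedD:
  assumes "adic_separated q" "\<And>k. q ^ k dvd x - y"
  shows "x = y"
  using assms unfolding adic_separated_def by (metis eq_iff_diff_eq_0)

text \<open>Banach's principle: successive iterates agree modulo \<open>q ^ k\<close>. The closed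
  set \<open>S\<close> carries properties that completeness alone does not give, such as
  restrictedness of power series.\<close>

lemma adic_contraction_fixpoint:
  fixes q :: "'a :: comm_ring_1"
  assumes q: "adic_complete q"
    and S0: "S x0" and S\<Phi>: "\<And>x. S x \<Longrightarrow> S (\<Phi> x)"
    and closed: "\<And>l f. (\<And>k. S (f k)) \<Longrightarrow> (\<And>k. q ^ k dvd l - f k) \<Longrightarrow> S l"
    and contr: "\<And>x y k. q ^ k dvd x - y \<Longrightarrow> q ^ Suc k dvd \<Phi> x - \<Phi> y"
  obtains x where "S x" "\<Phi> x = x"
proof -
  define f where "f k = (\<Phi> ^^ k) x0" for k
  have Sf: "S (f k)" for k
    by (induction k) (auto simp: f_def S0 S\<Phi>)
  have "q ^ k dvd f (Suc k) - f k" for k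
    by (induction k) (use contr in \<open>auto simp: f_def\<close>)
  then obtain l where l: "\<And>k. q ^ k dvd l - f k"
    using q unfolding adic_complete_def by blast
  have "q ^ k dvd \<Phi> l - l" for k
  proof -
    have "q ^ Suc k dvd \<Phi> l - f (Suc k)"
      using contr[OF l, of k] by (simp add: f_def)
    then have "q ^ Suc k dvd \<Phi> l - l"
      using l[of "Suc k"] by (rule dvd_diff_right_common)
    then show ?thesis
      by (metis dvd_mult_right power_Suc)
  qed
  then have "\<Phi> l = l"
    using q adic_separatedD unfolding adic_complete_def by blast
  with closed[OF Sf l] that show thesis by blast
qed

text \<open>The geometric series, obtained as the fixed point of v = 1 - q m v.\<close>

lemma adic_complete_one_plus_unit:
  fixes q :: "'a :: comm_ring_1"
  assumes "adic_complete q"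
  shows "1 + q * m dvd 1"
proof -
  obtain v where "1 - q * m * v = v"
  proof (rule adic_contraction_fixpoint[OF assms, where S = "\<lambda>_. True" and \<Phi> = "\<lambda>v. 1 - q * m * v"])
    fix x y k assume "q ^ k dvd x - y"
    then have "q * q ^ k dvd q * ((y - x) * m)"
      by (intro mult_dvd_mono dvd_refl dvd_mult2) (simp add: dvd_diff_sym)
    then show "q ^ Suc k dvd 1 - q * m * x - (1 - q * m * y)"
      by (simp add: algebra_simps)
  qed auto
  then have "1 = (1 + q * m) * v"
    by (simp add: algebra_simps)
  then show ?thesis by (rule dvdI)
qed

lemma adic_sums_unique:
  assumes "adic_separated q" "adic_sums q f s" "adic_sums q f t"
  shows "s = t"
proof (rule adic_separatedD[OF assms(1)])
  fix k
  have "\<forall>\<^sub>F n in sequentially. q ^ k dvd (\<Sum>i<n. f i) - s \<and> q ^ k dvd (\<Sum>i<n. f i) - t"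
    using assms(2,3) unfolding adic_sums_def by (simp add: eventually_conj)
  then obtain n where "q ^ k dvd (\<Sum>i<n. f i) - s" "q ^ k dvd (\<Sum>i<n. f i) - t"
    unfolding eventually_sequentially by blast
  then show "q ^ k dvd s - t"
    by (rule dvd_diff_left_common)
qed

lemma adic_suminf_eq:
  assumes "adic_separated q" "adic_sums q f s"
  shows "adic_suminf q f = s"
  unfolding adic_suminf_def using assms adic_sums_unique by blast

lemma adic_sumsI:
  assumes "\<And>k n. n \<ge> N k \<Longrightarrow> q ^ k dvd (\<Sum>i<n. f i) - s"
  shows "adic_sums q f s"
  unfolding adic_sums_def eventually_sequentially using assms by blast

lemma dvd_sum_diff_of_tail:
  fixes f :: "nat \<Rightarrow> 'a :: comm_ring_1"
  assumes "\<And>n. n \<ge> N \<Longrightarrow> d dvd f n" "N \<le> m" "N \<le> n"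
  shows "d dvd (\<Sum>i<n. f i) - (\<Sum>i<m. f i)"
proof -
  have *: "d dvd (\<Sum>i<l. f i) - (\<Sum>i<N. f i)" if "N \<le> l" for l
    using that
  proof (induction rule: dec_induct)
    case (step l)
    then show ?case
      using dvd_add[OF step.IH assms(1)[OF step.hyps(1)]] by (simp add: algebra_simps)
  qed simp
  show ?thesis
    using *[OF assms(3)] *[OF assms(2)] by (rule dvd_diff_right_common)
qed

lemma adic_summable:
  fixes f :: "nat \<Rightarrow> 'a :: comm_ring_1"
  assumes q: "adic_complete q" and f: "\<And>k n. n \<ge> N k \<Longrightarrow> q ^ k dvd f n"
  obtains s where "adic_sums q f s" "\<And>k n. n \<ge> N k \<Longrightarrow> q ^ k dvd (\<Sum>i<n. f i) - s"
proof -
  \<comment> \<open>\<open>N\<close> need not be monotone. The cumulative sums dominate it and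
    increase, so \<open>M (Suc k)\<close> also lies beyond \<open>N k\<close>.\<close>
  define M where "M k = (\<Sum>j\<le>k. N j)" for k
  have M: "N k \<le> M k" "M k \<le> M (Suc k)" for k
    unfolding M_def by (auto intro: member_le_sum)
  have "q ^ k dvd (\<Sum>i<M (Suc k). f i) - (\<Sum>i<M k. f i)" for k
    using f M order_trans[OF M(1) M(2)] by (intro dvd_sum_diff_of_tail[of "N k"]) auto
  then obtain l where l: "\<And>k. q ^ k dvd l - (\<Sum>i<M k. f i)"
    using q unfolding adic_complete_def by meson
  have "q ^ k dvd (\<Sum>i<n. f i) - l" if "n \<ge> N k" for k n
  proof (rule dvd_diff_trans)
    show "q ^ k dvd (\<Sum>i<n. f i) - (\<Sum>i<M k. f i)"
      using f M that by (intro dvd_sum_diff_of_tail[of "N k"]) auto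
    show "q ^ k dvd (\<Sum>i<M k. f i) - l"
      using l[of k] by (simp add: dvd_diff_sym)
  qed
  with that adic_sumsI show thesis by blast
qed


section \<open>Arithmetic of p-adic integers\<close>

abbreviation (input) padic_p :: "'p :: prime_card padic_int" where
  "padic_p \<equiv> of_nat CARD('p)"

lemma CARD_gt_1: "1 < CARD('p :: prime_card)"
  using prime_gt_1_nat[OF prime_card] .

lemma padic_nth_p_power:
  "padic_nth (padic_p ^ n * x :: 'p :: prime_card padic_int) k =
     (int CARD('p) ^ n * padic_nth x k) mod int CARD('p) ^ k"
proof -
  have "(padic_p :: 'p padic_int) ^ n = of_nat (CARD('p) ^ n)" by simp
  then show ?thesis
    by (simp only: times_padic_int.rep_eq padic_nth_of_nat) (simp add: mod_simps)
qed

lemma padic_int_eqI: "(\<And>n. padic_nth x n = padic_nth y n) \<Longrightarrow> x = y"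
  by (metis padic_nth_inject ext)

lemma padic_p_power_dvd_iff:
  fixes x :: "'p :: prime_card padic_int"
  shows "padic_p ^ n dvd x \<longleftrightarrow> padic_nth x n = 0"
proof
  assume "padic_p ^ n dvd x"
  then show "padic_nth x n = 0"
    by (auto elim!: dvdE simp: padic_nth_p_power)
next
  assume 0: "padic_nth x n = 0"
  let ?p = "int CARD('p)"
  \<comment> \<open>The quotient by \<open>p ^ n\<close>: once the residue at level n vanishes, all
    later residues are multiples of \<open>p ^ n\<close>, and dividing them shifts the level by
    n.\<close>
  define h where "h k = padic_nth x (n + k) div ?p ^ n" for k
  have h: "padic_nth x (n + k) = ?p ^ n * h k" for k
    using padic_nth_mod[of x n k] 0 unfolding h_def by auto
  have "0 \<le> h k \<and> h k < ?p ^ k \<and> h (Suc k) mod ?p ^ k = h k" for k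
  proof (intro conjI)
    have pos: "0 < ?p ^ n" by (rule CARD_pos_int)
    show "0 \<le> h k"
      using padic_nth_range(1)[of x "n + k"] pos by (simp add: h_def pos_imp_zdiv_nonneg_iff)
    show "h k < ?p ^ k"
      using padic_nth_range(2)[of x "n + k"] pos by (simp add: h power_add)
    have "padic_nth x (n + Suc k) mod ?p ^ (n + k) = padic_nth x (n + k)"
      using padic_nth_mod[of x "n + k" 1] by simp
    then have "?p ^ n * (h (Suc k) mod ?p ^ k) = ?p ^ n * h k"
      by (simp only: h power_add mult_mod_right)
    then show "h (Suc k) mod ?p ^ k = h k"
      using pos by simp
  qed
  then have h_nth: "padic_nth (Abs_padic_int h :: 'p padic_int) = h"
    by (intro Abs_padic_int_inverse) auto
  have "x = padic_p ^ n * Abs_padic_int h"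
    using padic_nth_mod[of x k n for k]
    by (intro padic_int_eqI) (simp add: padic_nth_p_power h_nth flip: h, simp add: add.commute)
  then show "padic_p ^ n dvd x" by simp
qed

lemma padic_nth_eq_iff:
  fixes x y :: "'p :: prime_card padic_int"
  shows "padic_p ^ n dvd x - y \<longleftrightarrow> padic_nth x n = padic_nth y n"
proof -
  have "padic_nth (x - y) n = 0 \<longleftrightarrow> padic_nth x n mod int CARD('p) ^ n = padic_nth y n mod int CARD('p) ^ n"
    by (simp add: minus_padic_int.rep_eq mod_eq_dvd_iff mod_eq_0_iff_dvd)
  then show ?thesis
    by (simp add: padic_p_power_dvd_iff padic_nth_range)
qed

lemma adic_separated_padic: "adic_separated (padic_p :: 'p :: prime_card padic_int)"
  unfolding adic_separated_def padic_p_power_dvd_iff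
  by (auto intro!: padic_int_eqI simp: zero_padic_int.rep_eq)

lemma adic_complete_padic: "adic_complete (padic_p :: 'p :: prime_card padic_int)"
  unfolding adic_complete_def
proof (intro conjI allI impI adic_separated_padic)
  fix f :: "nat \<Rightarrow> 'p padic_int"
  assume f: "\<forall>k. padic_p ^ k dvd f (Suc k) - f k"
  \<comment> \<open>Diagonal choice: \<open>f k\<close> is trusted exactly to level k.\<close>
  define h where "h k = padic_nth (f k) k" for k
  have "0 \<le> h k \<and> h k < int CARD('p) ^ k \<and> h (Suc k) mod int CARD('p) ^ k = h k" for k
    using f padic_nth_mod[of "f (Suc k)" k 1] unfolding padic_nth_eq_iff h_def
    by (simp add: padic_nth_range)
  then have "padic_nth (Abs_padic_int h :: 'p padic_int) = h"
    by (intro Abs_padic_int_inverse) auto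
  then show "\<exists>l. \<forall>k. padic_p ^ k dvd l - f k"
    unfolding padic_nth_eq_iff by (intro exI[of _ "Abs_padic_int h"]) (simp add: h_def)
qed

lemma padic_nth_of_int:
  "padic_nth (of_int m :: 'p :: prime_card padic_int) n = m mod int CARD('p) ^ n"
  by (cases m) (simp_all add: padic_nth_of_nat minus_padic_int.rep_eq uminus_padic_int.rep_eq
      one_padic_int.rep_eq mod_simps)

lemma padic_nth_1_mod: "padic_nth (x :: 'p :: prime_card padic_int) 1 mod int CARD('p) = padic_nth x 1"
  using padic_nth_range[of x 1] by simp

lemma of_int_mod_ring_cong:
  "(of_int_mod_ring a :: 'p :: prime_card mod_ring) = of_int_mod_ring b \<longleftrightarrow>
    a mod int CARD('p) = b mod int CARD('p)"
  by (transfer) simp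

lemma padic_red_eq_of_int: "padic_red (x :: 'p :: prime_card padic_int) = of_int (padic_nth x 1)"
  by (simp add: padic_red_def of_int_of_int_mod_ring)

lemma of_int_mod_card: "(of_int (a mod int CARD('p)) :: 'p :: prime_card mod_ring) = of_int a"
  by (simp add: of_int_of_int_mod_ring of_int_mod_ring_cong)

lemma padic_red_add: "padic_red (x + y) = padic_red x + padic_red (y :: 'p :: prime_card padic_int)"
  by (simp add: padic_red_eq_of_int plus_padic_int.rep_eq of_int_mod_card)

lemma padic_red_diff: "padic_red (x - y) = padic_red x - padic_red (y :: 'p :: prime_card padic_int)"
  by (simp add: padic_red_eq_of_int minus_padic_int.rep_eq of_int_mod_card)

lemma padic_red_mult: "padic_red (x * y) = padic_red x * padic_red (y :: 'p :: prime_card padic_int)"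
  by (simp add: padic_red_eq_of_int times_padic_int.rep_eq of_int_mod_card)

lemma padic_red_of_int: "padic_red (of_int m) = (of_int m :: 'p :: prime_card mod_ring)"
  by (simp add: padic_red_eq_of_int padic_nth_of_int of_int_mod_card)

lemma padic_red_0: "padic_red 0 = (0 :: 'p :: prime_card mod_ring)"
  and padic_red_1: "padic_red 1 = (1 :: 'p :: prime_card mod_ring)"
  and padic_red_numeral: "padic_red (numeral k) = (numeral k :: 'p :: prime_card mod_ring)"
  using padic_red_of_int[of 0] padic_red_of_int[of 1] padic_red_of_int[of "numeral k"] by simp_all

lemma padic_red_eq_0_iff: "padic_red x = 0 \<longleftrightarrow> padic_p dvd (x :: 'p :: prime_card padic_int)"
proof -
  have "padic_red x = 0 \<longleftrightarrow> padic_nth x 1 mod int CARD('p) = 0"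
    unfolding padic_red_def by transfer simp
  then show ?thesis
    using padic_p_power_dvd_iff[of 1 x] padic_nth_1_mod[of x] by simp
qed

lemma padic_red_eq_iff: "padic_red x = padic_red y \<longleftrightarrow> padic_p dvd x - (y :: 'p :: prime_card padic_int)"
  by (metis padic_red_diff padic_red_eq_0_iff eq_iff_diff_eq_0)

lemma padic_red_least_rep: "padic_red (least_rep r) = r"
  by (simp add: least_rep_def padic_red_of_int of_int_of_int_mod_ring)

lemma padic_red_p: "padic_red (padic_p :: 'p :: prime_card padic_int) = 0"
  by (simp add: padic_red_eq_0_iff)

lemma residue_disk_eq: "residue_disk r = {t. padic_red t = r}"
proof -
  have "t \<in> residue_disk r \<longleftrightarrow> padic_p dvd t - least_rep r" for t
    unfolding residue_disk_def dvd_def by (auto simp: algebra_simps)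
  also have "padic_p dvd t - least_rep r \<longleftrightarrow> padic_red t = r" for t
    by (simp flip: padic_red_eq_iff add: padic_red_least_rep)
  finally show ?thesis by blast
qed

text \<open>Lifting an inverse from the residue field moves x into 1 + p Z_p, whose elements are
  units by completeness.\<close>

lemma padic_unit_iff: "x dvd 1 \<longleftrightarrow> padic_red (x :: 'p :: prime_card padic_int) \<noteq> 0"
proof
  assume "x dvd 1"
  then obtain y where "x * y = 1" by (metis dvdE)
  then show "padic_red x \<noteq> 0"
    by (metis padic_red_mult padic_red_1 mult_zero_left zero_neq_one)
next
  assume "padic_red x \<noteq> 0"
  then have "padic_red (x * least_rep (inverse (padic_red x))) = padic_red 1"
    by (simp add: padic_red_mult padic_red_1 padic_red_least_rep)
  then obtain m where "x * least_rep (inverse (padic_red x)) = 1 + padic_p * m"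
    unfolding padic_red_eq_iff by (auto elim!: dvdE simp: algebra_simps)
  with adic_complete_one_plus_unit[OF adic_complete_padic, of m] show "x dvd 1"
    by (metis dvd_mult_left)
qed

lemma padic_p_neq_0: "(padic_p :: 'p :: prime_card padic_int) \<noteq> 0"
  by simp

lemma padic_decompose:
  fixes x :: "'p :: prime_card padic_int"
  assumes "x \<noteq> 0"
  obtains n u where "x = padic_p ^ n * u" "u dvd 1"
proof -
  \<comment> \<open>The valuation is one less than the first level with nonzero residue; level 0
    always has residue 0.\<close>
  define m where "m = (LEAST n. padic_nth x n \<noteq> 0)"
  have "\<exists>n. padic_nth x n \<noteq> 0"
    using assms by (metis padic_int_eqI zero_padic_int.rep_eq)
  then have m: "padic_nth x m \<noteq> 0"
    unfolding m_def by (rule LeastI_ex)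
  have "m \<noteq> 0" using m padic_nth_range[of x 0] by (intro notI) auto
  then obtain n where n: "m = Suc n" by (cases m) auto
  have "padic_nth x n = 0"
    using not_less_Least[of n "\<lambda>n. padic_nth x n \<noteq> 0"] n unfolding m_def by simp
  then obtain u where u: "x = padic_p ^ n * u"
    by (auto simp flip: padic_p_power_dvd_iff)
  have "\<not> padic_p dvd u"
    using m unfolding padic_p_power_dvd_iff[symmetric] n u by (auto elim!: dvdE simp: algebra_simps)
  then show thesis
    using that u by (simp add: padic_unit_iff padic_red_eq_0_iff)
qed

lemma padic_p_power_dvd_decomposed:
  fixes u :: "'p :: prime_card padic_int"
  assumes "u dvd 1"
  shows "padic_p ^ k dvd padic_p ^ n * u \<longleftrightarrow> k \<le> n"
proof
  assume *: "padic_p ^ k dvd padic_p ^ n * u"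
  show "k \<le> n"
  proof (rule ccontr)
    assume "\<not> k \<le> n"
    then have "padic_p ^ n * padic_p dvd padic_p ^ n * u"
      using * by (metis le_imp_power_dvd dvd_trans not_less_eq_eq power_Suc2)
    then have "padic_p dvd u" by simp
    with assms show False by (simp add: padic_unit_iff padic_red_eq_0_iff)
  qed
qed (simp add: le_imp_power_dvd)

lemma padic_val_decomposed:
  fixes u :: "'p :: prime_card padic_int"
  assumes "u dvd 1"
  shows "padic_val (padic_p ^ n * u) = enat n"
proof -
  have "u \<noteq> 0" using assms by auto
  moreover have "(GREATEST k. padic_p ^ k dvd padic_p ^ n * u) = n"
    using assms by (intro Greatest_equality) (auto simp: padic_p_power_dvd_decomposed)
  ultimately show ?thesis
    unfolding padic_val_def by simp
qed

lemma padic_val_mult_p_power_unit: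
  fixes x u :: "'p :: prime_card padic_int"
  assumes "u dvd 1"
  shows "padic_val (padic_p ^ n * (x * u)) = enat n + padic_val x"
proof (cases "x = 0")
  case False
  then obtain m v where x: "x = padic_p ^ m * v" "v dvd 1" by (rule padic_decompose)
  have "padic_p ^ n * (x * u) = padic_p ^ (n + m) * (v * u)"
    by (simp add: x power_add)
  moreover have "v * u dvd 1" using x assms by simp
  ultimately show ?thesis
    using x by (simp only: padic_val_decomposed) simp
qed (simp add: padic_val_def)

text \<open>Lets approximation modulo high powers of p serve as approximation modulo any nonzero
  element, for instance modulo x - y.\<close>

lemma padic_dvd_p_power:
  fixes x :: "'p :: prime_card padic_int"
  assumes "x \<noteq> 0"
  obtains n where "x dvd padic_p ^ n"
proof -
  obtain n u where "x = padic_p ^ n * u" "u dvd 1"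
    using assms by (rule padic_decompose)
  then have "x dvd padic_p ^ n" by (simp add: mult_unit_dvd_iff)
  then show thesis by (rule that)
qed

text \<open>The valuation ring property, with the factor p recording that the second alternative is
  strict.\<close>

lemma padic_dvd_linear:
  fixes x y :: "'p :: prime_card padic_int"
  shows "x dvd y \<or> padic_p * y dvd x"
proof (cases "x = 0 \<or> y = 0")
  case False
  then obtain n u m v where "x = padic_p ^ n * u" "u dvd 1" "y = padic_p ^ m * v" "v dvd 1"
    by (metis padic_decompose)
  then show ?thesis
    by (cases "n \<le> m") (auto simp: mult_unit_dvd_iff dvd_mult_unit_iff le_imp_power_dvd
        dvd_mult2 simp flip: mult.assoc power_Suc)
qed auto

lemma padic_prime_dvd_square:
  fixes x :: "'p :: prime_card padic_int"
  assumes "padic_p dvd x ^ 2"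
  shows "padic_p dvd x"
  using assms by (simp flip: padic_red_eq_0_iff add: power2_eq_square padic_red_mult)


section \<open>Restricted power series\<close>

lemma fps_const_dvd_iff:
  fixes c :: "'a :: comm_ring_1"
  shows "fps_const c dvd f \<longleftrightarrow> (\<forall>n. c dvd fps_nth f n)"
proof
  assume "\<forall>n. c dvd fps_nth f n"
  then obtain h where "\<And>n. fps_nth f n = c * h n"
    unfolding dvd_def by metis
  then have "f = fps_const c * Abs_fps h"
    by (intro fps_ext) simp
  then show "fps_const c dvd f" by simp
qed (auto elim!: dvdE)

lemma fps_const_dvdD: "fps_const c dvd f - g \<Longrightarrow> c dvd fps_nth f n - fps_nth (g :: 'a :: comm_ring_1 fps) n"
  by (metis fps_const_dvd_iff fps_sub_nth)

text \<open>Divisibility by a constant is coefficientwise, so limits are formed coefficient by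
  coefficient. That the limit of restricted series is restricted is a separate fact,
  \<open>restricted_limit\<close>.\<close>

lemma adic_complete_fps:
  fixes q :: "'a :: comm_ring_1"
  assumes "adic_complete q"
  shows "adic_complete (fps_const q)"
  unfolding adic_complete_def adic_separated_def
proof (intro conjI allI impI)
  fix f :: "'a fps"
  assume "\<forall>k. fps_const q ^ k dvd f"
  then show "f = 0"
    using assms unfolding adic_complete_def adic_separated_def
    by (intro fps_ext) (simp add: fps_const_power fps_const_dvd_iff)
next
  fix f :: "nat \<Rightarrow> 'a fps"
  assume f: "\<forall>k. fps_const q ^ k dvd f (Suc k) - f k"
  have "\<exists>l. \<forall>k. q ^ k dvd l - fps_nth (f k) n" for n
  proof -
    have "\<forall>k. q ^ k dvd fps_nth (f (Suc k)) n - fps_nth (f k) n"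
      using f by (simp add: fps_const_power fps_const_dvd_iff)
    then show ?thesis
      using assms unfolding adic_complete_def by (elim conjE allE[of _ "\<lambda>k. fps_nth (f k) n"]) auto
  qed
  then obtain l where l: "\<And>n k. q ^ k dvd l n - fps_nth (f k) n" by metis
  then show "\<exists>l. \<forall>k. fps_const q ^ k dvd l - f k"
    by (intro exI[of _ "Abs_fps l"]) (simp add: fps_const_power fps_const_dvd_iff)
qed

text \<open>Restricted series are the p-adic closure of the polynomials. In this form ring
  operations and evaluation are transferred from polynomials.\<close>

lemma restricted_iff:
  fixes f :: "'p :: prime_card padic_int fps"
  shows "restricted f \<longleftrightarrow> (\<forall>k. \<exists>P. fps_const (padic_p ^ k) dvd f - fps_of_poly P)"
proof
  assume f: "restricted f"
  show "\<forall>k. \<exists>P. fps_const (padic_p ^ k) dvd f - fps_of_poly P"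
  proof
    fix k
    obtain N where N: "\<And>n. n \<ge> N \<Longrightarrow> padic_p ^ k dvd fps_nth f n"
      using f unfolding restricted_def eventually_sequentially by blast
    have "padic_p ^ k dvd fps_nth f n - coeff (Poly (map (fps_nth f) [0..<N])) n" for n
      using N[of n] by (cases "n < N") (auto simp: nth_default_def)
    then show "\<exists>P. fps_const (padic_p ^ k) dvd f - fps_of_poly P"
      by (intro exI[of _ "Poly (map (fps_nth f) [0..<N])"]) (simp add: fps_const_dvd_iff)
  qed
next
  assume f: "\<forall>k. \<exists>P. fps_const (padic_p ^ k) dvd f - fps_of_poly P"
  show "restricted f"
    unfolding restricted_def
  proof
    fix k
    obtain P where P: "\<And>n. padic_p ^ k dvd fps_nth f n - coeff P n"
      using f by (auto simp: fps_const_dvd_iff)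
    have "padic_p ^ k dvd fps_nth f n" if "n \<ge> Suc (degree P)" for n
      using P[of n] that by (simp add: coeff_eq_0)
    then show "\<forall>\<^sub>F n in sequentially. padic_p ^ k dvd fps_nth f n"
      unfolding eventually_sequentially by blast
  qed
qed

lemma restricted_approx:
  fixes f :: "'p :: prime_card padic_int fps"
  assumes "restricted f"
  obtains P where "fps_const (padic_p ^ k) dvd f - fps_of_poly P"
  using assms unfolding restricted_iff by blast

lemma poly_eq_sum_lessThan:
  fixes P :: "'a :: comm_ring_1 poly"
  assumes "degree P < n"
  shows "poly P x = (\<Sum>i<n. coeff P i * x ^ i)"
  unfolding poly_altdef
  by (rule sum.mono_neutral_left) (use assms in \<open>auto simp: coeff_eq_0\<close>)

lemma adic_sums_restricted:
  fixes f :: "'p :: prime_card padic_int fps"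
  assumes "restricted f"
  shows "adic_sums padic_p (\<lambda>n. fps_nth f n * y ^ n) (restricted_eval f y)"
proof -
  have "\<exists>N. \<forall>n\<ge>N. padic_p ^ k dvd fps_nth f n" for k
    using assms unfolding restricted_def eventually_sequentially by blast
  then obtain N where "\<And>k n. n \<ge> N k \<Longrightarrow> padic_p ^ k dvd fps_nth f n" by metis
  then have "padic_p ^ k dvd fps_nth f n * y ^ n" if "n \<ge> N k" for k n
    using that by (simp add: dvd_mult2)
  then obtain s where "adic_sums padic_p (\<lambda>n. fps_nth f n * y ^ n) s"
    by (rule adic_summable[OF adic_complete_padic, of N])
  then show ?thesis
    unfolding restricted_eval_def by (simp add: adic_suminf_eq[OF adic_separated_padic])
qed

lemma restricted_eval_approx:
  fixes f :: "'p :: prime_card padic_int fps"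
  assumes "restricted f" and P: "fps_const (padic_p ^ k) dvd f - fps_of_poly P"
  shows "padic_p ^ k dvd restricted_eval f y - poly P y"
proof -
  obtain N where N: "\<And>n. n \<ge> N \<Longrightarrow>
      padic_p ^ k dvd (\<Sum>i<n. fps_nth f i * y ^ i) - restricted_eval f y"
    using adic_sums_restricted[OF assms(1), of y]
    unfolding adic_sums_def eventually_sequentially by blast
  define n where "n = max N (Suc (degree P))"
  have "(\<Sum>i<n. fps_nth f i * y ^ i) - poly P y = (\<Sum>i<n. (fps_nth f i - coeff P i) * y ^ i)"
    by (simp add: poly_eq_sum_lessThan[of P n] n_def left_diff_distrib sum_subtractf)
  also have "padic_p ^ k dvd \<dots>"
    using fps_const_dvdD[OF P] by (intro dvd_sum) (simp add: dvd_mult2)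
  finally show ?thesis
    by (rule dvd_diff_left_common[rotated]) (use N[of n] in \<open>simp add: n_def\<close>)
qed

text \<open>One polynomial must approximate both the coefficients of f and the value s;
  restrictedness of f then comes for free.\<close>

lemma restricted_eval_eqI:
  fixes f :: "'p :: prime_card padic_int fps"
  assumes "\<And>k. \<exists>P. fps_const (padic_p ^ k) dvd f - fps_of_poly P \<and> padic_p ^ k dvd s - poly P y"
  shows "restricted_eval f y = s"
proof -
  have "restricted f" unfolding restricted_iff using assms by blast
  show ?thesis
  proof (rule adic_separatedD[OF adic_separated_padic])
    fix k
    obtain P where P: "fps_const (padic_p ^ k) dvd f - fps_of_poly P" "padic_p ^ k dvd s - poly P y"
      using assms by blast
    show "padic_p ^ k dvd restricted_eval f y - s"
      using restricted_eval_approx[OF \<open>restricted f\<close> P(1)] P(2) by (rule dvd_diff_right_common)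
  qed
qed

lemma dvd_mult_diff_mult:
  fixes d :: "'a :: comm_ring_1"
  assumes "d dvd f - f'" "d dvd g - g'"
  shows "d dvd f * g - f' * g'"
proof -
  have "f * g - f' * g' = f * (g - g') + g' * (f - f')"
    by (simp add: algebra_simps)
  then show ?thesis using assms by simp
qed

lemma restricted_fps_of_poly: "restricted (fps_of_poly P :: 'p :: prime_card padic_int fps)"
  unfolding restricted_iff by (metis diff_self dvd_0_right)

lemma restricted_add:
  fixes f g :: "'p :: prime_card padic_int fps"
  assumes "restricted f" "restricted g"
  shows "restricted (f + g)"
  unfolding restricted_iff
proof
  fix k
  obtain P R where "fps_const (padic_p ^ k) dvd f - fps_of_poly P" "fps_const (padic_p ^ k) dvd g - fps_of_poly R"
    using assms by (metis restricted_approx)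
  then show "\<exists>P. fps_const (padic_p ^ k) dvd f + g - fps_of_poly P"
    by (intro exI[of _ "P + R"]) (simp add: fps_of_poly_add add_diff_add dvd_add)
qed

lemma restricted_mult:
  fixes f g :: "'p :: prime_card padic_int fps"
  assumes "restricted f" "restricted g"
  shows "restricted (f * g)"
  unfolding restricted_iff
proof
  fix k
  obtain P R where "fps_const (padic_p ^ k) dvd f - fps_of_poly P" "fps_const (padic_p ^ k) dvd g - fps_of_poly R"
    using assms by (metis restricted_approx)
  then show "\<exists>P. fps_const (padic_p ^ k) dvd f * g - fps_of_poly P"
    by (intro exI[of _ "P * R"]) (simp add: fps_of_poly_mult dvd_mult_diff_mult)
qed

lemma restricted_const: "restricted (fps_const c :: 'p :: prime_card padic_int fps)"
  using restricted_fps_of_poly[of "[:c:]"] by (simp add: fps_of_poly_const)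

lemma restricted_1: "restricted (1 :: 'p :: prime_card padic_int fps)"
  using restricted_fps_of_poly[of 1] by simp

lemma restricted_X_power: "restricted (fps_X ^ n :: 'p :: prime_card padic_int fps)"
  using restricted_fps_of_poly[of "monom 1 n"] by (simp add: fps_of_poly_monom)

lemma restricted_diff:
  fixes f g :: "'p :: prime_card padic_int fps"
  assumes "restricted f" "restricted g"
  shows "restricted (f - g)"
  using restricted_add[OF assms(1) restricted_mult[OF restricted_const[of "-1"] assms(2)]]
  by (simp flip: fps_const_neg)

lemma restricted_shift:
  fixes f :: "'p :: prime_card padic_int fps"
  assumes "restricted f"
  shows "restricted (fps_shift n f)"
  unfolding restricted_def eventually_sequentially
proof
  fix k
  obtain N where "\<And>i. i \<ge> N \<Longrightarrow> padic_p ^ k dvd fps_nth f i"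
    using assms unfolding restricted_def eventually_sequentially by blast
  then show "\<exists>N. \<forall>i\<ge>N. padic_p ^ k dvd fps_nth (fps_shift n f) i"
    by (intro exI[of _ N]) simp
qed

lemma restricted_div_p_power:
  fixes f :: "'p :: prime_card padic_int fps"
  assumes "restricted (fps_const (padic_p ^ m) * f)"
  shows "restricted f"
  unfolding restricted_def eventually_sequentially
proof
  fix k
  obtain N where "\<And>i. i \<ge> N \<Longrightarrow> padic_p ^ (m + k) dvd fps_nth (fps_const (padic_p ^ m) * f) i"
    using assms unfolding restricted_def eventually_sequentially by blast
  then show "\<exists>N. \<forall>i\<ge>N. padic_p ^ k dvd fps_nth f i"
    by (intro exI[of _ N]) (simp add: power_add)
qed

lemma restricted_limit:
  fixes l :: "'p :: prime_card padic_int fps"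
  assumes "\<And>k. restricted (f k)" "\<And>k. fps_const padic_p ^ k dvd l - f k"
  shows "restricted l"
  unfolding restricted_iff
proof
  fix k
  obtain P where "fps_const (padic_p ^ k) dvd f k - fps_of_poly P"
    using assms(1) by (rule restricted_approx)
  with assms(2)[of k] have "fps_const (padic_p ^ k) dvd l - fps_of_poly P"
    unfolding fps_const_power by (rule dvd_diff_trans)
  then show "\<exists>P. fps_const (padic_p ^ k) dvd l - fps_of_poly P" ..
qed

lemma restricted_eval_fps_of_poly:
  "restricted_eval (fps_of_poly P) y = poly P (y :: 'p :: prime_card padic_int)"
  by (rule restricted_eval_eqI) (metis diff_self dvd_0_right)

lemma restricted_eval_add:
  fixes f g :: "'p :: prime_card padic_int fps"
  assumes "restricted f" "restricted g"
  shows "restricted_eval (f + g) y = restricted_eval f y + restricted_eval g y"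
proof (rule restricted_eval_eqI)
  fix k
  obtain P R where PR: "fps_const (padic_p ^ k) dvd f - fps_of_poly P" "fps_const (padic_p ^ k) dvd g - fps_of_poly R"
    using assms by (metis restricted_approx)
  then show "\<exists>P. fps_const (padic_p ^ k) dvd f + g - fps_of_poly P \<and>
      padic_p ^ k dvd restricted_eval f y + restricted_eval g y - poly P y"
    using restricted_eval_approx[OF assms(1) PR(1), of y] restricted_eval_approx[OF assms(2) PR(2), of y]
    by (intro exI[of _ "P + R"]) (simp add: fps_of_poly_add add_diff_add dvd_add)
qed

lemma restricted_eval_mult:
  fixes f g :: "'p :: prime_card padic_int fps"
  assumes "restricted f" "restricted g"
  shows "restricted_eval (f * g) y = restricted_eval f y * restricted_eval g y"
proof (rule restricted_eval_eqI)
  fix k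
  obtain P R where PR: "fps_const (padic_p ^ k) dvd f - fps_of_poly P" "fps_const (padic_p ^ k) dvd g - fps_of_poly R"
    using assms by (metis restricted_approx)
  have "restricted_eval f y * restricted_eval g y - poly P y * poly R y =
      restricted_eval f y * (restricted_eval g y - poly R y) + poly R y * (restricted_eval f y - poly P y)"
    by (simp add: algebra_simps)
  with PR show "\<exists>P. fps_const (padic_p ^ k) dvd f * g - fps_of_poly P \<and>
      padic_p ^ k dvd restricted_eval f y * restricted_eval g y - poly P y"
    using restricted_eval_approx[OF assms(1) PR(1), of y] restricted_eval_approx[OF assms(2) PR(2), of y]
    by (intro exI[of _ "P * R"]) (simp add: fps_of_poly_mult dvd_mult_diff_mult)
qed

lemma restricted_eval_const: "restricted_eval (fps_const c) y = (c :: 'p :: prime_card padic_int)"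
  using restricted_eval_fps_of_poly[of "[:c:]"] by (simp add: fps_of_poly_const)

lemma restricted_eval_X_power: "restricted_eval (fps_X ^ n) y = (y :: 'p :: prime_card padic_int) ^ n"
  using restricted_eval_fps_of_poly[of "monom 1 n"] by (simp add: fps_of_poly_monom poly_monom)

lemma restricted_eval_0_right:
  fixes f :: "'p :: prime_card padic_int fps"
  assumes "restricted f"
  shows "restricted_eval f 0 = fps_nth f 0"
proof (rule adic_separatedD[OF adic_separated_padic])
  fix k
  obtain P where P: "fps_const (padic_p ^ k) dvd f - fps_of_poly P"
    using assms by (rule restricted_approx)
  have "padic_p ^ k dvd fps_nth f 0 - poly P 0"
    using fps_const_dvdD[OF P, of 0] by (simp add: poly_0_coeff_0)
  with restricted_eval_approx[OF assms P, of 0] show "padic_p ^ k dvd restricted_eval f 0 - fps_nth f 0"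
    by (rule dvd_diff_right_common)
qed

section \<open>Differences of values, identity principle and order of vanishing of restricted
  series\<close>

lemma dvd_poly_diff: "x - y dvd poly P x - poly P (y :: 'a :: comm_ring_1)"
proof (induction P)
  case (pCons a P)
  have "poly (pCons a P) x - poly (pCons a P) y = x * (poly P x - poly P y) + (x - y) * poly P y"
    by (simp add: algebra_simps)
  with pCons.IH show ?case by simp
qed simp

text \<open>With P = a + X R, the difference of values is x (R x - R y) + R y (x - y), and R y is
  the linear coefficient of P modulo q. So on the ideal (q) the slope at 0 governs all
  differences.\<close>

lemma poly_diff_linear_approx:
  fixes q x y :: "'a :: comm_ring_1"
  assumes "q dvd x" "q dvd y"
  shows "q * (x - y) dvd poly P x - poly P y - coeff P 1 * (x - y)"
proof (cases P)
  case (pCons a R)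
  have "q dvd poly R y - coeff R 0"
    using dvd_trans[OF assms(2)] dvd_poly_diff[of y 0 R] by (simp add: poly_0_coeff_0)
  then have "q * (x - y) dvd x * (poly R x - poly R y) + (poly R y - coeff R 0) * (x - y)"
    using assms dvd_poly_diff[of x y R] by (intro dvd_add mult_dvd_mono) auto
  then show ?thesis
    by (simp add: pCons algebra_simps)
qed

lemma restricted_eval_diff_approx:
  fixes f :: "'p :: prime_card padic_int fps"
  assumes f: "restricted f" and xy: "padic_p dvd x" "padic_p dvd y"
  shows "padic_p * (x - y) dvd restricted_eval f x - restricted_eval f y - fps_nth f 1 * (x - y)"
proof (cases "x = y")
  case False
  \<comment> \<open>At this precision, replacing f by a polynomial costs only multiples of p (x -
    y).\<close>
  then obtain n where n: "padic_p * (x - y) dvd padic_p ^ n"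
    by (metis padic_dvd_p_power mult_eq_0_iff padic_p_neq_0 right_minus_eq)
  obtain P where P: "fps_const (padic_p ^ n) dvd f - fps_of_poly P"
    using f by (rule restricted_approx)
  have "padic_p dvd fps_nth f 1 - coeff P 1"
    using dvd_trans[OF dvd_mult_left[OF n] fps_const_dvdD[OF P, of 1]] by simp
  then have "padic_p * (x - y) dvd restricted_eval f x - poly P x"
    "padic_p * (x - y) dvd restricted_eval f y - poly P y"
    "padic_p * (x - y) dvd (fps_nth f 1 - coeff P 1) * (x - y)"
    using dvd_trans[OF n restricted_eval_approx[OF f P]] by (simp_all add: mult_dvd_mono)
  from dvd_diff[OF dvd_diff[OF this(1,2)] this(3)]
  have "padic_p * (x - y) dvd restricted_eval f x - poly P x - (restricted_eval f y - poly P y)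
     - (fps_nth f 1 - coeff P 1) * (x - y)" .
  from dvd_add[OF this poly_diff_linear_approx[OF xy, of P]] show ?thesis
    by (simp add: algebra_simps)
qed simp

lemma restricted_eval_diff:
  fixes f :: "'p :: prime_card padic_int fps"
  assumes f: "restricted f"
  shows "x - y dvd restricted_eval f x - restricted_eval f y"
proof (cases "x = y")
  case False
  then obtain n where n: "x - y dvd padic_p ^ n"
    by (metis padic_dvd_p_power right_minus_eq)
  obtain P where P: "fps_const (padic_p ^ n) dvd f - fps_of_poly P"
    using f by (rule restricted_approx)
  have "x - y dvd restricted_eval f x - poly P x" "x - y dvd restricted_eval f y - poly P y"
    using dvd_trans[OF n restricted_eval_approx[OF f P]] by simp_all
  from dvd_diff_right_common[OF dvd_diff_trans[OF this(1) dvd_poly_diff] this(2)] show ?thesis .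
qed simp

text \<open>Plays the part of a limit y \<rightarrow> 0: a constant congruent to 0 modulo every
  nonzero increment vanishes.\<close>

lemma padic_eq_0_if_all_dvd:
  fixes c :: "'p :: prime_card padic_int"
  assumes "\<And>y. y \<noteq> 0 \<Longrightarrow> y dvd c"
  shows "c = 0"
proof -
  have "padic_p ^ k dvd c" for k by (rule assms) simp
  then show ?thesis
    using adic_separated_padic[where 'p = 'p] unfolding adic_separated_def by blast
qed

lemma restricted_eval_factor:
  fixes f :: "'p :: prime_card padic_int fps"
  assumes "restricted f" "f \<noteq> 0"
  obtains g where "restricted g" "fps_nth g 0 \<noteq> 0"
    "\<And>y. restricted_eval f y = y ^ subdegree f * restricted_eval g y"
proof
  let ?g = "fps_shift (subdegree f) f"
  show "restricted ?g" using assms restricted_shift by blast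
  show "fps_nth ?g 0 \<noteq> 0" using assms by simp
  show "restricted_eval f y = y ^ subdegree f * restricted_eval ?g y" for y
    using restricted_eval_mult[OF restricted_X_power \<open>restricted ?g\<close>, of "subdegree f" y]
      subdegree_decompose[of f] by (simp add: restricted_eval_X_power mult.commute)
qed

text \<open>After the lowest power of the variable is divided out, the cofactor vanishes at every y
  \<noteq> 0. Its constant term is then divisible by every such y.\<close>

lemma restricted_eval_eq_0D:
  fixes f :: "'p :: prime_card padic_int fps"
  assumes f: "restricted f" and 0: "\<And>y. restricted_eval f y = 0"
  shows "f = 0"
proof (rule ccontr)
  assume "f \<noteq> 0"
  then obtain g where g: "restricted g" "fps_nth g 0 \<noteq> 0"
    "\<And>y. restricted_eval f y = y ^ subdegree f * restricted_eval g y"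
    using f restricted_eval_factor by blast
  have "y dvd fps_nth g 0" if "y \<noteq> 0" for y
    using g(3)[of y] 0[of y] that restricted_eval_diff[OF g(1), of 0 y]
    by (simp add: restricted_eval_0_right[OF g(1)])
  with padic_eq_0_if_all_dvd g(2) show False by blast
qed

lemma restricted_eqI:
  fixes f g :: "'p :: prime_card padic_int fps"
  assumes "restricted f" "restricted g" "\<And>y. restricted_eval f y = restricted_eval g y"
  shows "f = g"
proof -
  have "restricted_eval (f - g) y = 0" for y
    using restricted_eval_add[OF restricted_diff[OF assms(1,2)] assms(2), of y] assms(3) by simp
  then have "f - g = 0"
    using assms by (intro restricted_eval_eq_0D restricted_diff)
  then show ?thesis by simp
qed

text \<open>Reads the order off the values. If it differed from m, cancelling the smaller power of y
  would leave a nonzero constant on one side and a multiple of y on the other. \<open>D\<close> is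
  only a function, so a Lipschitz condition at 0 stands in for a series.\<close>

lemma restricted_subdegree_eqI:
  fixes f :: "'p :: prime_card padic_int fps"
  assumes f: "restricted f" and D: "\<And>y. restricted_eval f y = y ^ m * D y"
    and D_cont: "\<And>y. y dvd D y - D 0" and D0: "D 0 \<noteq> 0"
  shows "f \<noteq> 0 \<and> subdegree f = m"
proof -
  have nz: "\<exists>y. y \<noteq> 0 \<and> \<not> y dvd D 0"
    using padic_eq_0_if_all_dvd D0 by blast
  have "f \<noteq> 0"
  proof
    assume "f = 0"
    then have "D y = 0" if "y \<noteq> 0" for y
      using D[of y] that restricted_eval_const[of 0 y] by simp
    with nz D_cont show False by (metis diff_0 dvd_minus_iff)
  qed
  then obtain g where g: "restricted g" "fps_nth g 0 \<noteq> 0"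
    "\<And>y. restricted_eval f y = y ^ subdegree f * restricted_eval g y"
    using f restricted_eval_factor by blast
  have gy: "y dvd restricted_eval g y - fps_nth g 0" for y
    using restricted_eval_diff[OF g(1), of y 0] by (simp add: restricted_eval_0_right[OF g(1)])
  have eq: "y ^ m * D y = y ^ subdegree f * restricted_eval g y" for y
    using D g(3) by metis
  consider "subdegree f = m" | "subdegree f < m" | "m < subdegree f" by linarith
  then show ?thesis
  proof cases
    case 2
    have "y dvd fps_nth g 0" if "y \<noteq> 0" for y
    proof -
      have "y ^ subdegree f * (y ^ (m - subdegree f) * D y) = y ^ subdegree f * restricted_eval g y"
        using eq[of y] 2 by (simp flip: mult.assoc power_add)
      then have "restricted_eval g y = y ^ (m - subdegree f) * D y"
        using that by simp
      then have "y dvd restricted_eval g y"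
        using 2 by (simp add: dvd_mult2 dvd_power)
      from dvd_diff[OF this gy[of y]] show ?thesis by simp
    qed
    with padic_eq_0_if_all_dvd g(2) show ?thesis by blast
  next
    case 3
    have "y dvd D 0" if "y \<noteq> 0" for y
    proof -
      have "y ^ m * D y = y ^ m * (y ^ (subdegree f - m) * restricted_eval g y)"
        using eq[of y] 3 by (simp flip: mult.assoc power_add)
      then have "D y = y ^ (subdegree f - m) * restricted_eval g y"
        using that by simp
      then have "y dvd D y"
        using 3 by (simp add: dvd_mult2 dvd_power)
      from dvd_diff[OF this D_cont[of y]] show ?thesis by simp
    qed
    with nz show ?thesis by blast
  qed (use \<open>f \<noteq> 0\<close> in blast)
qed

section \<open>Units and Weierstrass factorisation of restricted series\<close>

lemma restricted_unitI:
  fixes f :: "'p :: prime_card padic_int fps"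
  assumes f: "restricted f" and f0: "fps_nth f 0 dvd 1"
    and fn: "\<And>n. n > 0 \<Longrightarrow> padic_p dvd fps_nth f n"
  shows "restricted_unit f"
proof -
  obtain c where c: "c * fps_nth f 0 = 1" using f0 by (metis dvdE mult.commute)
  \<comment> \<open>Normalising the constant term gives 1 + p m with m restricted; its inverse is
    the fixed point of v = 1 - p m v.\<close>
  have "fps_const padic_p dvd fps_const c * f - 1"
    unfolding fps_const_dvd_iff using c fn by (auto simp: dvd_mult)
  then obtain m where m: "fps_const c * f - 1 = fps_const padic_p * m" by (elim dvdE)
  have "restricted (fps_const (padic_p ^ 1) * m)"
    using restricted_diff[OF restricted_mult[OF restricted_const f] restricted_1] by (simp flip: m)
  then have rm: "restricted m" by (rule restricted_div_p_power)
  let ?\<Phi> = "\<lambda>v. 1 - fps_const padic_p * m * v"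
  obtain v where v: "restricted v" "?\<Phi> v = v"
  proof (rule adic_contraction_fixpoint[OF adic_complete_fps[OF adic_complete_padic], where
        S = restricted and \<Phi> = ?\<Phi> and ?x0.0 = 1])
    fix x y :: "'p padic_int fps" and k
    assume "fps_const padic_p ^ k dvd x - y"
    then have "fps_const padic_p * fps_const padic_p ^ k dvd fps_const padic_p * ((y - x) * m)"
      by (intro mult_dvd_mono dvd_refl dvd_mult2) (simp add: dvd_diff_sym)
    then show "fps_const padic_p ^ Suc k dvd ?\<Phi> x - ?\<Phi> y"
      by (simp add: algebra_simps)
  next
    fix l :: "'p padic_int fps" and f
    assume "\<And>k. restricted (f k)" "\<And>k. fps_const padic_p ^ k dvd l - f k"
    then show "restricted l" by (rule restricted_limit)
  qed (use rm in \<open>auto intro!: restricted_1 restricted_diff restricted_mult restricted_const\<close>)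
  have "fps_const c * f = 1 + fps_const padic_p * m"
    by (simp only: m[symmetric]) simp
  then have "f * (fps_const c * v) = (1 + fps_const padic_p * m) * v"
    by (metis mult.assoc mult.commute)
  also have "\<dots> = 1" using v(2) by (simp add: algebra_simps)
  finally show ?thesis
    unfolding restricted_unit_def using f v restricted_mult restricted_const by blast
qed

lemma restricted_unit_eval:
  fixes V :: "'p :: prime_card padic_int fps"
  assumes "restricted_unit V"
  shows "restricted_eval V y dvd 1"
proof -
  obtain g where g: "restricted V" "restricted g" "V * g = 1"
    using assms unfolding restricted_unit_def by blast
  then have "restricted_eval V y * restricted_eval g y = 1"
    using restricted_eval_mult[of V g y] restricted_eval_const[of 1 y] by simp
  then show ?thesis by (metis dvdI)
qed

text \<open>Dividing by \<open>V1\<close> gives W1 - W2 = W2 D. The left side has degree below d,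
  while W2 is X^d modulo p, which forces every power of p to divide D.\<close>

lemma weierstrass_factor_unique:
  fixes W1 W2 :: "'p :: prime_card padic_int poly"
  assumes W1: "distinguished W1" "degree W1 = d" and W2: "distinguished W2" "degree W2 = d"
    and V1: "restricted_unit V1"
    and eq: "fps_of_poly W1 * V1 = fps_of_poly W2 * V2"
  shows "W1 = W2"
proof -
  obtain g where g: "V1 * g = 1" using V1 unfolding restricted_unit_def by blast
  define D where "D = V2 * g - 1"
  have D: "fps_of_poly (W1 - W2) = fps_of_poly W2 * D"
  proof -
    have "fps_of_poly W1 = fps_of_poly W2 * V2 * g"
      by (metis eq g mult.assoc mult.right_neutral)
    then show ?thesis
      by (simp add: D_def fps_of_poly_diff right_diff_distrib mult.assoc)
  qed
  have "coeff (W1 - W2) n = 0" if "n \<ge> d" for n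
    using that W1 W2 by (cases "n = d") (auto simp: distinguished_def coeff_eq_0)
  then have shift0: "fps_shift d (fps_of_poly W2 * D) = 0"
    by (intro fps_ext) (simp flip: D)
  have "fps_const padic_p dvd fps_of_poly W2 - fps_X ^ d"
    unfolding fps_const_dvd_iff
  proof
    fix n
    consider "n < d" | "n = d" | "n > d" by linarith
    then show "padic_p dvd fps_nth (fps_of_poly W2 - fps_X ^ d) n"
      using W2 by cases (auto simp: distinguished_def coeff_eq_0)
  qed
  then obtain L where "fps_of_poly W2 - fps_X ^ d = fps_const padic_p * L" by (elim dvdE)
  then have L: "fps_of_poly W2 = fps_X ^ d + fps_const padic_p * L"
    by (simp add: algebra_simps)
  \<comment> \<open>Written with W2 = X^d + p L, the vanishing of the part from degree d on
    expresses D as p times a shift of L D up to sign, so each use gains a factor p.\<close>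
  have D_fix: "D + fps_const padic_p * fps_shift d (L * D) = 0"
  proof -
    have "fps_shift d (fps_of_poly W2 * D) = D + fps_const padic_p * fps_shift d (L * D)"
      unfolding L by (intro fps_ext) (simp add: distrib_right mult.assoc fps_X_power_mult_nth)
    with shift0 show ?thesis by simp
  qed
  have "fps_const (padic_p ^ k) dvd D" for k
  proof (induction k)
    case (Suc k)
    then have "fps_const (padic_p ^ k) dvd L * D" by simp
    then have "fps_const (padic_p ^ k) dvd fps_shift d (L * D)"
      unfolding fps_const_dvd_iff by simp
    then have "fps_const padic_p * fps_const (padic_p ^ k) dvd fps_const padic_p * fps_shift d (L * D)"
      by (intro mult_dvd_mono) auto
    moreover have "D = - (fps_const padic_p * fps_shift d (L * D))"
      using D_fix by (rule eq_neg_iff_add_eq_0[THEN iffD2])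
    ultimately show ?case
      by (metis dvd_minus_iff fps_const_mult power_Suc)
  qed simp
  then have "D = 0"
    using adic_complete_fps[OF adic_complete_padic, where 'p1 = 'p]
    unfolding adic_complete_def adic_separated_def by (auto simp: fps_const_power)
  with D show ?thesis by (simp add: fps_of_poly_diff)
qed

text \<open>After division by a unit, \<open>H = Y\<^sup>d + p L\<close>. A multiplier \<open>v\<close> turns this into a monic polynomial
  of degree \<open>d\<close> iff the part of \<open>v (Y\<^sup>d + p L)\<close> divisible by \<open>Y\<^sup>d\<close> is \<open>Y\<^sup>d\<close>, which is a fixed point
  equation for a p-adic contraction.\<close>

lemma weierstrass_preparation:
  fixes H :: "'p :: prime_card padic_int fps"
  assumes H: "restricted H" and Hd: "fps_nth H d dvd 1"
    and Hn: "\<And>n. n \<noteq> d \<Longrightarrow> padic_p dvd fps_nth H n"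
  obtains W V where "distinguished W" "degree W = d" "restricted_unit V" "H = fps_of_poly W * V"
proof -
  let ?p = "fps_const padic_p :: 'p padic_int fps"
  \<comment> \<open>The constant term of e is the unit coefficient of Y^d and all others are
    divisible by p. So e is a unit, and dividing by it normalises H to Y^d + p L.\<close>
  define e where "e = fps_shift d H"
  have "restricted_unit e"
    unfolding e_def using H Hd Hn by (intro restricted_unitI restricted_shift) auto
  then obtain e' where e: "restricted e" "restricted e'" "e * e' = 1"
    unfolding restricted_unit_def by blast
  have "?p dvd H - fps_X ^ d * e"
    unfolding fps_const_dvd_iff by (auto simp: e_def fps_X_power_mult_nth Hn)
  then obtain L0 where L0: "H - fps_X ^ d * e = ?p * L0" by (elim dvdE)
  have "restricted (fps_const (padic_p ^ 1) * L0)"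
    using restricted_diff[OF H restricted_mult[OF restricted_X_power e(1)]] by (simp flip: L0)
  then have "restricted L0" by (rule restricted_div_p_power)
  define L where "L = L0 * e'"
  have L: "restricted L" unfolding L_def using \<open>restricted L0\<close> e(2) by (rule restricted_mult)
  have He: "H * e' = fps_X ^ d + ?p * L"
  proof -
    have "H * e' = (fps_X ^ d * e + ?p * L0) * e'"
      using L0 by (simp add: algebra_simps)
    also have "\<dots> = fps_X ^ d * (e * e') + ?p * L"
      by (simp add: L_def algebra_simps)
    finally show ?thesis by (simp add: e)
  qed
  let ?\<Phi> = "\<lambda>v. 1 - ?p * fps_shift d (v * L)"
  obtain v where v: "restricted v" "?\<Phi> v = v"
  proof (rule adic_contraction_fixpoint[OF adic_complete_fps[OF adic_complete_padic], where
        S = restricted and \<Phi> = ?\<Phi> and ?x0.0 = 1])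
    fix x y :: "'p padic_int fps" and k
    assume "?p ^ k dvd x - y"
    then have "?p ^ k dvd (y - x) * L" by (simp add: dvd_diff_sym)
    then have "?p ^ k dvd fps_shift d ((y - x) * L)"
      unfolding fps_const_power fps_const_dvd_iff by simp
    then have "?p * ?p ^ k dvd ?p * fps_shift d ((y - x) * L)"
      by (intro mult_dvd_mono) auto
    moreover have "?p * fps_shift d ((y - x) * L) = ?\<Phi> x - ?\<Phi> y"
      by (intro fps_ext) (simp add: algebra_simps)
    ultimately show "?p ^ Suc k dvd ?\<Phi> x - ?\<Phi> y" by simp
  next
    fix l :: "'p padic_int fps" and f
    assume "\<And>k. restricted (f k)" "\<And>k. ?p ^ k dvd l - f k"
    then show "restricted l" by (rule restricted_limit)
  qed (use L in \<open>auto intro!: restricted_1 restricted_diff restricted_mult restricted_const restricted_shift\<close>)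
  have v_nth: "fps_nth v n = (if n = 0 then 1 else 0) - padic_p * fps_nth (v * L) (n + d)" for n
    by (subst v(2)[symmetric]) simp
  have v0: "padic_red (fps_nth v 0) = 1"
    unfolding v_nth[of 0] by (simp add: padic_red_diff padic_red_mult padic_red_1 padic_red_p)
  have "restricted_unit v"
    using v(1) by (rule restricted_unitI) (auto simp: padic_unit_iff v0, simp add: v_nth)
  then obtain v' where v': "restricted v'" "v * v' = 1"
    unfolding restricted_unit_def by blast
  define G where "G = v * (H * e')"
  have G_nth: "fps_nth G n = (if n < d then 0 else fps_nth v (n - d)) + padic_p * fps_nth (v * L) n" for n
  proof -
    have "G = fps_X ^ d * v + ?p * (v * L)"
      unfolding G_def He by (simp add: algebra_simps)
    then show ?thesis by (simp add: fps_X_power_mult_nth)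
  qed
  \<comment> \<open>The fixed point equation at degree n - d cancels the p-part of G exactly. Hence
    G is a monic polynomial and truncating it at degree d loses nothing.\<close>
  have G_ge: "fps_nth G n = (if n = d then 1 else 0)" if "n \<ge> d" for n
    using that v_nth[of "n - d"] unfolding G_nth by simp
  define W where "W = Poly (map (fps_nth G) [0..<Suc d])"
  have W_nth: "coeff W n = fps_nth G n" for n
    using G_ge[of n] by (auto simp: W_def nth_default_def simp del: upt_Suc)
  have "degree W = d"
    by (rule antisym[OF degree_le le_degree]) (auto simp: W_nth G_ge)
  moreover from this have "distinguished W"
    unfolding distinguished_def by (auto simp: W_nth G_ge) (simp add: G_nth)
  moreover have "H = fps_of_poly W * (v' * e)"
  proof -
    have "fps_of_poly W = G" by (intro fps_ext) (simp add: W_nth)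
    then have "fps_of_poly W * (v' * e) = H * (v * v') * (e * e')"
      by (simp add: G_def algebra_simps)
    then show ?thesis by (simp add: v' e)
  qed
  moreover have "restricted_unit (v' * e)"
  proof -
    have "v' * e * (v * e') = (v * v') * (e * e')" by (simp add: algebra_simps)
    then show ?thesis
      unfolding restricted_unit_def using e v v' restricted_mult by (metis mult_1)
  qed
  ultimately show thesis using that by blast
qed


section \<open>Traces of finite free algebras\<close>

text \<open>The target class is the one that \<open>mod_p\<close> satisfies, where 0 \<noteq> 1 is
  not guaranteed. One trace theory thus covers both A and its reduction.\<close>

locale scalar_hom =
  fixes \<iota> :: "'r :: comm_ring_1 \<Rightarrow> 'a :: {comm_ring, comm_monoid_mult}"
  assumes hom_add: "\<iota> (x + y) = \<iota> x + \<iota> y"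
    and hom_mult: "\<iota> (x * y) = \<iota> x * \<iota> y"
    and hom_1: "\<iota> 1 = 1"
begin

lemma hom_0: "\<iota> 0 = 0"
  using hom_add[of 0 0] by simp

lemma hom_uminus: "\<iota> (- x) = - \<iota> x"
  using hom_add[of "- x" x] by (simp add: hom_0 eq_neg_iff_add_eq_0)

lemma hom_diff: "\<iota> (x - y) = \<iota> x - \<iota> y"
  using hom_add[of x "- y"] by (simp add: hom_uminus)

lemma hom_sum: "\<iota> (\<Sum>i\<in>S. f i) = (\<Sum>i\<in>S. \<iota> (f i))"
  by (induction S rule: infinite_finite_induct) (simp_all add: hom_0 hom_add)

lemma is_alg_basisI:
  assumes span: "\<And>x. \<exists>c. x = (\<Sum>i<n. \<iota> (c i) * b i)"
    and indep: "\<And>c i. (\<Sum>i<n. \<iota> (c i) * b i) = 0 \<Longrightarrow> i < n \<Longrightarrow> c i = 0"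
  shows "is_alg_basis \<iota> n b"
  unfolding is_alg_basis_def
proof
  fix x
  obtain c where c: "x = (\<Sum>i<n. \<iota> (c i) * b i)" using span by blast
  show "\<exists>!c. c \<in> {..<n} \<rightarrow>\<^sub>E UNIV \<and> x = (\<Sum>i<n. \<iota> (c i) * b i)"
  proof (rule ex1I[of _ "restrict c {..<n}"])
    show "restrict c {..<n} \<in> {..<n} \<rightarrow>\<^sub>E UNIV \<and> x = (\<Sum>i<n. \<iota> (restrict c {..<n} i) * b i)"
      using c by auto
    fix c' assume c': "c' \<in> {..<n} \<rightarrow>\<^sub>E UNIV \<and> x = (\<Sum>i<n. \<iota> (c' i) * b i)"
    then have "(\<Sum>i<n. \<iota> (c' i - c i) * b i) = 0"
      using c by (simp add: hom_diff left_diff_distrib sum_subtractf)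
    then have "c' i = c i" if "i < n" for i
      using indep[of "\<lambda>i. c' i - c i" i] that by simp
    then show "c' = restrict c {..<n}"
      using c' by (intro extensionalityI[of _ "{..<n}"]) (auto simp: PiE_def)
  qed
qed

context
  fixes n :: nat and b :: "nat \<Rightarrow> 'a"
  assumes basis: "is_alg_basis \<iota> n b"
begin

lemma alg_coords_expand: "x = (\<Sum>i<n. \<iota> (alg_coords \<iota> n b x i) * b i)"
  using theI'[OF basis[unfolded is_alg_basis_def, rule_format, of x]]
  unfolding alg_coords_def by blast

lemma alg_coords_eqI:
  assumes "x = (\<Sum>i<n. \<iota> (c i) * b i)" "i < n"
  shows "alg_coords \<iota> n b x i = c i"
proof -
  have "alg_coords \<iota> n b x = restrict c {..<n}"
    unfolding alg_coords_def
    by (rule the1_equality[OF basis[unfolded is_alg_basis_def, rule_format, of x]])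
      (use assms(1) in auto)
  then show ?thesis using assms(2) by simp
qed

lemma alg_coords_sum:
  assumes "i < n"
  shows "alg_coords \<iota> n b (\<Sum>j\<in>J. \<iota> (c j) * y j) i = (\<Sum>j\<in>J. c j * alg_coords \<iota> n b (y j) i)"
proof (rule alg_coords_eqI[OF _ assms])
  have "(\<Sum>j\<in>J. \<iota> (c j) * y j) = (\<Sum>j\<in>J. \<iota> (c j) * (\<Sum>i<n. \<iota> (alg_coords \<iota> n b (y j) i) * b i))"
    using alg_coords_expand by simp
  also have "\<dots> = (\<Sum>i<n. \<Sum>j\<in>J. \<iota> (c j) * (\<iota> (alg_coords \<iota> n b (y j) i) * b i))"
    unfolding sum_distrib_left by (rule sum.swap)
  also have "\<dots> = (\<Sum>i<n. \<iota> (\<Sum>j\<in>J. c j * alg_coords \<iota> n b (y j) i) * b i)"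
    by (simp add: hom_sum hom_mult sum_distrib_right mult.assoc)
  finally show "(\<Sum>j\<in>J. \<iota> (c j) * y j) = \<dots>" .
qed

lemma alg_coords_basis:
  assumes "i < n" "k < n"
  shows "alg_coords \<iota> n b (b k) i = (if i = k then 1 else 0)"
  using assms
  by (intro alg_coords_eqI) (simp_all add: if_distrib[of \<iota>] hom_1 hom_0 if_distrib[of "\<lambda>x. x * _"] cong: if_cong)

end

text \<open>With transition matrices M and N, the trace of M A N equals that of A (N M), and N M is
  the identity.\<close>

lemma alg_coords_trace_indep:
  assumes b: "is_alg_basis \<iota> n b" and b': "is_alg_basis \<iota> n b'"
  shows "(\<Sum>i<n. alg_coords \<iota> n b' (x * b' i) i) = (\<Sum>i<n. alg_coords \<iota> n b (x * b i) i)"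
proof -
  define M where "M j i = alg_coords \<iota> n b (b' j) i" for j i
  define N where "N k j = alg_coords \<iota> n b' (b k) j" for k j
  define A where "A i k = alg_coords \<iota> n b (x * b i) k" for i k
  have xb': "x * b' j = (\<Sum>i<n. \<iota> (M j i) * (x * b i))" for j
  proof -
    have "x * b' j = x * (\<Sum>i<n. \<iota> (M j i) * b i)"
      unfolding M_def using alg_coords_expand[OF b, of "b' j"] by simp
    then show ?thesis by (simp add: sum_distrib_left mult.left_commute)
  qed
  have NA: "alg_coords \<iota> n b' (x * b i) j = (\<Sum>k<n. A i k * N k j)" if "j < n" for i j
    using alg_coords_sum[OF b' that, of "A i" b "{..<n}"] alg_coords_expand[OF b, of "x * b i"]
    by (simp add: A_def N_def)
  have NM: "(\<Sum>j<n. N k j * M j i) = (if i = k then 1 else 0)" if "i < n" "k < n" for i k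
    using alg_coords_sum[OF b that(1), of "N k" b' "{..<n}"] alg_coords_expand[OF b', of "b k"]
      alg_coords_basis[OF b that] by (simp add: M_def N_def)
  have "(\<Sum>j<n. alg_coords \<iota> n b' (x * b' j) j) = (\<Sum>j<n. \<Sum>i<n. M j i * (\<Sum>k<n. A i k * N k j))"
    by (rule sum.cong) (simp_all add: xb' alg_coords_sum[OF b'] NA)
  also have "\<dots> = (\<Sum>i<n. \<Sum>j<n. \<Sum>k<n. A i k * (N k j * M j i))"
    by (subst sum.swap) (simp add: sum_distrib_left mult_ac)
  also have "\<dots> = (\<Sum>i<n. \<Sum>k<n. A i k * (\<Sum>j<n. N k j * M j i))"
    by (rule sum.cong[OF refl], subst sum.swap) (simp add: sum_distrib_left)
  also have "\<dots> = (\<Sum>i<n. A i i)"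
    by (intro sum.cong refl) (simp add: NM if_distrib[of "\<lambda>x. _ * x"] cong: if_cong)
  finally show ?thesis by (simp add: A_def)
qed

lemma alg_trace_eq:
  assumes "is_alg_basis \<iota> n b"
  shows "alg_trace \<iota> n x = (\<Sum>i<n. alg_coords \<iota> n b (x * b i) i)"
proof -
  have "is_alg_basis \<iota> n (SOME b. is_alg_basis \<iota> n b)"
    using assms by (rule someI[of "is_alg_basis \<iota> n"])
  then show ?thesis
    unfolding alg_trace_def Let_def using assms alg_coords_trace_indep by blast
qed

lemma alg_trace_sum:
  assumes b: "is_alg_basis \<iota> n b"
  shows "alg_trace \<iota> n (\<Sum>j\<in>J. \<iota> (c j) * y j) = (\<Sum>j\<in>J. c j * alg_trace \<iota> n (y j))"
proof -
  have "alg_coords \<iota> n b ((\<Sum>j\<in>J. \<iota> (c j) * y j) * b i) i =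
      (\<Sum>j\<in>J. c j * alg_coords \<iota> n b (y j * b i) i)" if "i < n" for i
    using alg_coords_sum[OF b that, of c "\<lambda>j. y j * b i" J]
    by (simp add: sum_distrib_right mult.assoc)
  then have "alg_trace \<iota> n (\<Sum>j\<in>J. \<iota> (c j) * y j) =
      (\<Sum>i<n. \<Sum>j\<in>J. c j * alg_coords \<iota> n b (y j * b i) i)"
    by (simp add: alg_trace_eq[OF b])
  also have "\<dots> = (\<Sum>j\<in>J. c j * alg_trace \<iota> n (y j))"
    by (subst sum.swap) (simp add: alg_trace_eq[OF b] sum_distrib_left)
  finally show ?thesis .
qed

lemma alg_trace_scale:
  assumes "is_alg_basis \<iota> n b"
  shows "alg_trace \<iota> n (\<iota> c * y) = c * alg_trace \<iota> n y"
  using alg_trace_sum[OF assms, of "\<lambda>_. c" "\<lambda>_. y" "{()}"] by simp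

lemma alg_trace_diff:
  assumes "is_alg_basis \<iota> n b"
  shows "alg_trace \<iota> n (x - y) = alg_trace \<iota> n x - alg_trace \<iota> n y"
  using alg_trace_sum[OF assms, of "\<lambda>j. if j then 1 else - 1" "\<lambda>j. if j then x else y" UNIV]
  by (simp add: UNIV_bool hom_1 hom_uminus)

end

section \<open>Completeness of A and reduction of bases and traces modulo p\<close>

lemma scalar_hom_comm_ring_hom:
  assumes "comm_ring_hom \<iota>"
  shows "scalar_hom \<iota>"
proof -
  interpret comm_ring_hom \<iota> by fact
  show ?thesis by standard (simp_all add: hom_distribs)
qed

lemma to_mod_p_add: "to_mod_p (x + y) = (to_mod_p x + to_mod_p y :: ('a :: comm_ring_1, 'p :: prime_card) mod_p)"
  by (simp add: plus_mod_p.abs_eq)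

lemma to_mod_p_mult: "to_mod_p (x * y) = (to_mod_p x * to_mod_p y :: ('a :: comm_ring_1, 'p :: prime_card) mod_p)"
  by (simp add: times_mod_p.abs_eq)

lemma to_mod_p_1: "to_mod_p 1 = (1 :: ('a :: comm_ring_1, 'p :: prime_card) mod_p)"
  by (simp add: one_mod_p_def)

lemma to_mod_p_power: "to_mod_p (x ^ k) = (to_mod_p x ^ k :: ('a :: comm_ring_1, 'p :: prime_card) mod_p)"
  by (induction k) (simp_all add: to_mod_p_1 to_mod_p_mult)

lemma to_mod_p_0: "to_mod_p 0 = (0 :: ('a :: comm_ring_1, 'p :: prime_card) mod_p)"
  by (simp add: zero_mod_p_def)

lemma to_mod_p_sum: "to_mod_p (\<Sum>i\<in>S. f i) = (\<Sum>i\<in>S. to_mod_p (f i) :: ('a :: comm_ring_1, 'p :: prime_card) mod_p)"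
  by (induction S rule: infinite_finite_induct) (simp_all add: to_mod_p_0 to_mod_p_add)

lemma to_mod_p_eq_iff:
  "(to_mod_p x :: ('a :: comm_ring_1, 'p :: prime_card) mod_p) = to_mod_p y \<longleftrightarrow> of_nat CARD('p) dvd x - y"
  by (rule mod_p.abs_eq_iff)

lemma to_mod_p_surj: "\<exists>x. (z :: ('a :: comm_ring_1, 'p :: prime_card) mod_p) = to_mod_p x"
  by (metis Quotient_mod_p Quotient_abs_rep)

context
  fixes \<iota> :: "'p :: prime_card padic_int \<Rightarrow> 'a :: comm_ring_1"
  assumes \<iota>: "comm_ring_hom \<iota>"
begin

interpretation \<iota>: comm_ring_hom \<iota> by (rule \<iota>)
interpretation S: scalar_hom \<iota> using \<iota> by (rule scalar_hom_comm_ring_hom)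

lemma structure_map_p_power: "\<iota> (padic_p ^ k) = of_nat CARD('p) ^ k"
  by (simp add: \<iota>.hom_power \<iota>.hom_of_nat)

text \<open>Coordinates are linear over the structure map, so A carries the p-adic topology of
  Z_p^n; separatedness and completeness follow coordinatewise.\<close>

lemma p_power_dvd_iff_coords:
  assumes b: "is_alg_basis \<iota> n b"
  shows "of_nat CARD('p) ^ k dvd x \<longleftrightarrow> (\<forall>i<n. padic_p ^ k dvd alg_coords \<iota> n b x i)"
proof
  assume "of_nat CARD('p) ^ k dvd x"
  then obtain y where "x = \<iota> (padic_p ^ k) * y"
    unfolding structure_map_p_power by (elim dvdE)
  then show "\<forall>i<n. padic_p ^ k dvd alg_coords \<iota> n b x i"
    using S.alg_coords_sum[OF b, of _ "\<lambda>_. padic_p ^ k" "\<lambda>_. y" "{()}"] by simp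
next
  assume "\<forall>i<n. padic_p ^ k dvd alg_coords \<iota> n b x i"
  then have "\<iota> (padic_p ^ k) dvd (\<Sum>i<n. \<iota> (alg_coords \<iota> n b x i) * b i)"
    by (intro dvd_sum dvd_mult2 \<iota>.hom_dvd) simp
  then show "of_nat CARD('p) ^ k dvd x"
    unfolding structure_map_p_power using S.alg_coords_expand[OF b, of x] by simp
qed

lemma alg_coords_diff:
  assumes b: "is_alg_basis \<iota> n b" "i < n"
  shows "alg_coords \<iota> n b (x - y) i = alg_coords \<iota> n b x i - alg_coords \<iota> n b y i"
  using S.alg_coords_sum[OF b, of "\<lambda>j. if j then 1 else - 1" "\<lambda>j. if j then x else y" UNIV]
  by (simp add: UNIV_bool \<iota>.hom_uminus)

lemma adic_complete_alg:
  assumes b: "is_alg_basis \<iota> n b"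
  shows "adic_complete (of_nat CARD('p) :: 'a)"
  unfolding adic_complete_def adic_separated_def
proof (intro conjI allI impI)
  fix x :: 'a
  assume "\<forall>k. of_nat CARD('p) ^ k dvd x"
  then have "alg_coords \<iota> n b x i = 0" if "i < n" for i
    using adic_separated_padic[where 'p = 'p] that
    unfolding p_power_dvd_iff_coords[OF b] adic_separated_def by blast
  then show "x = 0"
    using S.alg_coords_expand[OF b, of x] by simp
next
  fix f :: "nat \<Rightarrow> 'a"
  assume f: "\<forall>k. of_nat CARD('p) ^ k dvd f (Suc k) - f k"
  have "\<exists>l. \<forall>k. padic_p ^ k dvd l - alg_coords \<iota> n b (f k) i" if "i < n" for i
  proof -
    have "\<forall>k. padic_p ^ k dvd alg_coords \<iota> n b (f (Suc k)) i - alg_coords \<iota> n b (f k) i"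
      using f that by (simp add: p_power_dvd_iff_coords[OF b] alg_coords_diff[OF b])
    then show ?thesis
      using adic_complete_padic[where 'p = 'p] unfolding adic_complete_def
      by (elim conjE allE[of _ "\<lambda>k. alg_coords \<iota> n b (f k) i"]) auto
  qed
  then obtain l where l: "\<And>i k. i < n \<Longrightarrow> padic_p ^ k dvd l i - alg_coords \<iota> n b (f k) i" by metis
  define x where "x = (\<Sum>i<n. \<iota> (l i) * b i)"
  have "alg_coords \<iota> n b x i = l i" if "i < n" for i
    using x_def that by (rule S.alg_coords_eqI[OF b])
  with l have "\<forall>k. of_nat CARD('p) ^ k dvd x - f k"
    by (simp add: p_power_dvd_iff_coords[OF b] alg_coords_diff[OF b])
  then show "\<exists>l. \<forall>k. of_nat CARD('p) ^ k dvd l - f k" ..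
qed

lemma p_power_dvd_alg_trace:
  assumes b: "is_alg_basis \<iota> n b" and "of_nat CARD('p) ^ k dvd x"
  shows "padic_p ^ k dvd alg_trace \<iota> n x"
proof -
  obtain y where "x = \<iota> (padic_p ^ k) * y"
    using assms(2) unfolding structure_map_p_power by (elim dvdE)
  then show ?thesis by (simp add: S.alg_trace_scale[OF b])
qed

text \<open>c and the least representative of its reduction differ by a multiple of p. The
  homomorphism laws of \<open>mod_p_scalar\<close>, which is defined through representatives, are
  all deduced from this.\<close>

lemma to_mod_p_structure_map: "(to_mod_p (\<iota> c) :: ('a, 'p) mod_p) = mod_p_scalar (padic_red c)"
proof -
  have "padic_p dvd c - of_int (to_int_mod_ring (padic_red c))"
    unfolding padic_red_eq_iff[symmetric] padic_red_of_int by (simp add: of_int_of_int_mod_ring)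
  then have "\<iota> padic_p dvd \<iota> (c - of_int (to_int_mod_ring (padic_red c)))"
    by (rule \<iota>.hom_dvd)
  then show ?thesis
    unfolding mod_p_scalar_def to_mod_p_eq_iff
    by (simp add: \<iota>.hom_minus \<iota>.hom_of_int \<iota>.hom_of_nat)
qed

lemma scalar_hom_mod_p: "scalar_hom (mod_p_scalar :: 'p mod_ring \<Rightarrow> ('a, 'p) mod_p)"
proof
  fix x y :: "'p mod_ring"
  have red: "padic_red (least_rep z) = z" for z :: "'p mod_ring"
    by (rule padic_red_least_rep)
  show "mod_p_scalar (x + y) = (mod_p_scalar x + mod_p_scalar y :: ('a, 'p) mod_p)"
    using to_mod_p_structure_map[of "least_rep x + least_rep y"]
      to_mod_p_structure_map[of "least_rep x"] to_mod_p_structure_map[of "least_rep y"]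
    by (simp add: red padic_red_add \<iota>.hom_add to_mod_p_add)
  show "mod_p_scalar (x * y) = (mod_p_scalar x * mod_p_scalar y :: ('a, 'p) mod_p)"
    using to_mod_p_structure_map[of "least_rep x * least_rep y"]
      to_mod_p_structure_map[of "least_rep x"] to_mod_p_structure_map[of "least_rep y"]
    by (simp add: red padic_red_mult \<iota>.hom_mult to_mod_p_mult)
  show "mod_p_scalar 1 = (1 :: ('a, 'p) mod_p)"
    using to_mod_p_structure_map[of 1] by (simp add: padic_red_1 to_mod_p_1)
qed

interpretation R: scalar_hom "mod_p_scalar :: 'p mod_ring \<Rightarrow> ('a, 'p) mod_p"
  by (rule scalar_hom_mod_p)

lemma to_mod_p_expand:
  assumes b: "is_alg_basis \<iota> n b"
  shows "(to_mod_p x :: ('a, 'p) mod_p) =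
    (\<Sum>i<n. mod_p_scalar (padic_red (alg_coords \<iota> n b x i)) * to_mod_p (b i))"
proof -
  have "(to_mod_p x :: ('a, 'p) mod_p) = to_mod_p (\<Sum>i<n. \<iota> (alg_coords \<iota> n b x i) * b i)"
    using S.alg_coords_expand[OF b, of x] by simp
  then show ?thesis
    by (simp add: to_mod_p_sum to_mod_p_mult to_mod_p_structure_map)
qed

lemma is_alg_basis_mod_p:
  assumes b: "is_alg_basis \<iota> n b"
  shows "is_alg_basis mod_p_scalar n (\<lambda>i. to_mod_p (b i) :: ('a, 'p) mod_p)"
proof (rule R.is_alg_basisI)
  fix z :: "('a, 'p) mod_p"
  obtain x where "z = to_mod_p x" using to_mod_p_surj by blast
  then show "\<exists>c. z = (\<Sum>i<n. mod_p_scalar (c i) * to_mod_p (b i))"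
    using to_mod_p_expand[OF b, of x] by (intro exI) simp
next
  fix c :: "nat \<Rightarrow> 'p mod_ring" and i
  assume 0: "(\<Sum>i<n. mod_p_scalar (c i) * to_mod_p (b i)) = (0 :: ('a, 'p) mod_p)" and i: "i < n"
  \<comment> \<open>Lifting the relation turns it into divisibility of x by p, which is read off in
    coordinates.\<close>
  define x where "x = (\<Sum>i<n. \<iota> (least_rep (c i)) * b i)"
  have "(to_mod_p x :: ('a, 'p) mod_p) = 0"
    using 0 by (simp add: x_def to_mod_p_sum to_mod_p_mult to_mod_p_structure_map padic_red_least_rep)
  then have "of_nat CARD('p) ^ 1 dvd x"
    using to_mod_p_eq_iff[where 'p = 'p, of x 0] by (simp add: to_mod_p_0)
  then have "padic_p dvd least_rep (c i)"
    unfolding p_power_dvd_iff_coords[OF b] using i S.alg_coords_eqI[OF b x_def i] by auto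
  then show "c i = 0"
    by (simp flip: padic_red_eq_0_iff add: padic_red_least_rep)
qed

text \<open>In the reduced basis the matrix of multiplication is reduced entrywise. This links the
  trace hypotheses over the residue field to divisibility by p in Z_p.\<close>

lemma alg_trace_to_mod_p:
  assumes b: "is_alg_basis \<iota> n b"
  shows "alg_trace mod_p_scalar n (to_mod_p x :: ('a, 'p) mod_p) = padic_red (alg_trace \<iota> n x)"
proof -
  have red_sum: "padic_red (sum f A) = (\<Sum>i\<in>A. padic_red (f i))" for f :: "nat \<Rightarrow> 'p padic_int" and A
    by (induction A rule: infinite_finite_induct) (simp_all add: padic_red_0 padic_red_add)
  have "alg_coords mod_p_scalar n (\<lambda>i. to_mod_p (b i)) (to_mod_p x * to_mod_p (b i) :: ('a, 'p) mod_p) i =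
      padic_red (alg_coords \<iota> n b (x * b i) i)" if "i < n" for i
    using that to_mod_p_expand[OF b, of "x * b i"] unfolding to_mod_p_mult
    by (intro R.alg_coords_eqI[OF is_alg_basis_mod_p[OF b]])
  then show ?thesis
    by (simp add: R.alg_trace_eq[OF is_alg_basis_mod_p[OF b]] S.alg_trace_eq[OF b] red_sum)
qed

end

section \<open>Nondegeneracy of the trace form\<close>

text \<open>With \<open>f\<close> the cubic minimal polynomial of \<open>\<omega>\<close>, Euler's formula says that the trace of \<open>y\<close> is
  the \<open>\<omega>\<^sup>2\<close>-coordinate of \<open>f'(\<omega>) y\<close>. As \<open>g(\<omega>) \<mapsto> g'(\<omega>)\<close> is a derivation modulo \<open>f'(\<omega>)\<close>, the
  vanishing of the differentials makes \<open>f'(\<omega>)\<close> invertible, so the trace form is nondegenerate.\<close>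

locale cubic_power_basis = scalar_hom \<iota>
  for \<iota> :: "'r :: comm_ring_1 \<Rightarrow> 'a :: {comm_ring, comm_monoid_mult}" +
  fixes \<omega> :: 'a
  assumes basis: "is_alg_basis \<iota> 3 (\<lambda>i. \<omega> ^ i)"
begin

definition lin :: "'r \<Rightarrow> 'r \<Rightarrow> 'r \<Rightarrow> 'a" where
  "lin a b c = \<iota> a + \<iota> b * \<omega> + \<iota> c * (\<omega> * \<omega>)"

abbreviation crd :: "'a \<Rightarrow> nat \<Rightarrow> 'r" where
  "crd \<equiv> alg_coords \<iota> 3 (\<lambda>i. \<omega> ^ i)"

lemma sum_eq_lin: "(\<Sum>i<3. \<iota> (c i) * \<omega> ^ i) = lin (c 0) (c 1) (c 2)"
  by (simp add: lin_def eval_nat_numeral)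

lemma lin_crd: "lin (crd y 0) (crd y 1) (crd y 2) = y"
  using alg_coords_expand[OF basis, of y] by (simp add: sum_eq_lin)

lemma crd_lin: "crd (lin a b c) 0 = a" "crd (lin a b c) 1 = b" "crd (lin a b c) 2 = c"
proof -
  have "lin a b c = (\<Sum>i<3. \<iota> ([a, b, c] ! i) * \<omega> ^ i)"
    by (simp add: sum_eq_lin)
  from alg_coords_eqI[OF basis this]
  show "crd (lin a b c) 0 = a" "crd (lin a b c) 1 = b" "crd (lin a b c) 2 = c"
    by simp_all
qed

lemma lin_eq_iff: "lin a b c = lin a' b' c' \<longleftrightarrow> a = a' \<and> b = b' \<and> c = c'"
  by (metis crd_lin)

text \<open>\<omega> is a root of the cubic f = X^3 - c2 X^2 - c1 X - c0.\<close>

definition c0 where "c0 = crd (\<omega> * (\<omega> * \<omega>)) 0"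
definition c1 where "c1 = crd (\<omega> * (\<omega> * \<omega>)) 1"
definition c2 where "c2 = crd (\<omega> * (\<omega> * \<omega>)) 2"

lemma omega_cubed: "\<omega> * (\<omega> * \<omega>) = \<iota> c0 + \<iota> c1 * \<omega> + \<iota> c2 * (\<omega> * \<omega>)"
  using lin_crd[of "\<omega> * (\<omega> * \<omega>)"] by (simp add: lin_def c0_def c1_def c2_def)

lemma omega_fourth: "\<omega> * (\<omega> * (\<omega> * \<omega>)) =
    \<iota> (c0 * c2) + \<iota> (c0 + c1 * c2) * \<omega> + \<iota> (c1 + c2 * c2) * (\<omega> * \<omega>)"
proof -
  have "\<omega> * (\<omega> * (\<omega> * \<omega>)) = \<iota> c0 * \<omega> + \<iota> c1 * (\<omega> * \<omega>) + \<iota> c2 * (\<omega> * (\<omega> * \<omega>))"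
    by (subst omega_cubed) (simp add: algebra_simps)
  then show ?thesis
    unfolding omega_cubed by (simp add: hom_add hom_mult algebra_simps)
qed

lemma lin_mult: "lin a0 a1 a2 * lin b0 b1 b2 =
  lin (a0 * b0 + c0 * (a1 * b2 + a2 * b1) + c0 * c2 * (a2 * b2))
    (a0 * b1 + a1 * b0 + c1 * (a1 * b2 + a2 * b1) + (c0 + c1 * c2) * (a2 * b2))
    (a0 * b2 + a1 * b1 + a2 * b0 + c2 * (a1 * b2 + a2 * b1) + (c1 + c2 * c2) * (a2 * b2))"
proof -
  have "lin a0 a1 a2 * lin b0 b1 b2 = \<iota> (a0 * b0) + \<iota> (a0 * b1 + a1 * b0) * \<omega>
      + \<iota> (a0 * b2 + a1 * b1 + a2 * b0) * (\<omega> * \<omega>)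
      + \<iota> (a1 * b2 + a2 * b1) * (\<omega> * (\<omega> * \<omega>)) + \<iota> (a2 * b2) * (\<omega> * (\<omega> * (\<omega> * \<omega>)))"
    unfolding lin_def by (simp add: hom_add hom_mult algebra_simps)
  then show ?thesis
    unfolding omega_fourth unfolding omega_cubed
    unfolding lin_def by (simp add: hom_add hom_mult algebra_simps)
qed

lemma lin_add: "lin a0 a1 a2 + lin b0 b1 b2 = lin (a0 + b0) (a1 + b1) (a2 + b2)"
  and lin_diff: "lin a0 a1 a2 - lin b0 b1 b2 = lin (a0 - b0) (a1 - b1) (a2 - b2)"
  unfolding lin_def by (simp_all add: hom_add hom_diff algebra_simps)

lemma lin_const: "\<iota> r = lin r 0 0" and lin_omega: "\<omega> = lin 0 1 0"
  and lin_omega_sq: "\<omega> ^ 2 = lin 0 0 1" and lin_zero: "0 = lin 0 0 0" and lin_one: "1 = lin 1 0 0"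
  by (simp_all add: lin_def hom_0 hom_1 power2_eq_square)

text \<open>The value f'(\<omega>) = 3 \<omega>^2 - 2 c2 \<omega> - c1.\<close>

definition different :: 'a where
  "different = lin (- c1) (- 2 * c2) 3"

text \<open>The map g(\<omega>) \<mapsto> g'(\<omega>), taken on the representative g of degree at
  most 2.\<close>

definition der :: "'a \<Rightarrow> 'a" where
  "der y = lin (crd y 1) (2 * crd y 2) 0"

lemma der_lin: "der (lin a b c) = lin b (2 * c) 0"
  by (simp only: der_def crd_lin)

lemma der_add: "der (x + y) = der x + der y"
proof -
  have "der (lin a0 a1 a2 + lin b0 b1 b2) = der (lin a0 a1 a2) + der (lin b0 b1 b2)" for a0 a1 a2 b0 b1 b2
    by (simp add: lin_add der_lin lin_eq_iff algebra_simps)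
  then show ?thesis by (metis lin_crd)
qed

text \<open>If g h = k f + s is division with remainder by f, then s' and (g h)' differ at \<omega>
  by k(\<omega>) f'(\<omega>). The witness is -k(\<omega>), where k = a2 b2 X + (a1 b2 + a2 b1 + c2
  a2 b2).\<close>

lemma der_mult: "\<exists>z. der (x * y) - x * der y - y * der x = different * z"
proof -
  have "der (lin a0 a1 a2 * lin b0 b1 b2) - lin a0 a1 a2 * der (lin b0 b1 b2)
      - lin b0 b1 b2 * der (lin a0 a1 a2) =
      different * lin (- (a1 * b2 + a2 * b1 + c2 * (a2 * b2))) (- (a2 * b2)) 0" for a0 a1 a2 b0 b1 b2
    by (simp add: different_def lin_mult der_lin lin_diff lin_eq_iff algebra_simps)
  then show ?thesis by (metis lin_crd)
qed

text \<open>The coefficients 3, c2 and 2 c1 + c2^2 are Newton's power sums for f.\<close>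

lemma trace_lin: "alg_trace \<iota> 3 (lin y0 y1 y2) = 3 * y0 + c2 * y1 + (2 * c1 + c2 * c2) * y2"
proof -
  have "alg_trace \<iota> 3 (lin y0 y1 y2) = crd (lin y0 y1 y2 * lin 1 0 0) 0
      + crd (lin y0 y1 y2 * lin 0 1 0) 1 + crd (lin y0 y1 y2 * lin 0 0 1) 2"
    unfolding alg_trace_eq[OF basis]
    by (simp add: eval_nat_numeral flip: lin_one lin_omega lin_omega_sq[unfolded eval_nat_numeral])
  then show ?thesis
    by (simp add: lin_mult crd_lin[unfolded One_nat_def] crd_lin algebra_simps)
qed

lemma trace_eq_crd: "alg_trace \<iota> 3 y = crd (different * y) 2"
proof -
  have "alg_trace \<iota> 3 (lin y0 y1 y2) = crd (different * lin y0 y1 y2) 2" for y0 y1 y2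
    by (simp add: trace_lin different_def lin_mult crd_lin algebra_simps)
  then show ?thesis by (metis lin_crd)
qed

text \<open>For w = f'(\<omega>) x the three traces are the top coordinates of w, w \<omega> and w
  \<omega>^2. They are triangular in w2, w1, w0 with unit diagonal, so w vanishes, and f'(\<omega>)
  is invertible.\<close>

lemma trace_nondegenerate:
  assumes unit: "different * z = 1"
    and tr: "alg_trace \<iota> 3 x = 0" "alg_trace \<iota> 3 (x * \<omega>) = 0" "alg_trace \<iota> 3 (x * \<omega> ^ 2) = 0"
  shows "x = 0"
proof -
  obtain w0 w1 w2 where w: "different * x = lin w0 w1 w2" by (metis lin_crd)
  have "crd (lin w0 w1 w2) 2 = 0" "crd (lin w0 w1 w2 * lin 0 1 0) 2 = 0"
    "crd (lin w0 w1 w2 * lin 0 0 1) 2 = 0"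
    using tr unfolding trace_eq_crd
    by (simp_all add: w flip: lin_omega lin_omega_sq mult.assoc)
  then have "w2 = 0 \<and> w1 = 0 \<and> w0 = 0"
    by (simp add: lin_mult crd_lin)
  then have "different * x = 0" using w lin_zero by simp
  then have "z * (different * x) = 0" by simp
  then show ?thesis
    using unit by (metis mult.assoc mult.commute mult_1)
qed

end

text \<open>The universal property of differentials, done by hand: the linear extension of a
  derivation modulo (f) sends every relation into (f). When everything is a relation, even the value
  of d on a single symbol lies in (f).\<close>

lemma kaehler_relations_derivation:
  fixes \<iota> :: "'p :: prime_card padic_int \<Rightarrow> 'a :: comm_ring_1"
    and d :: "'a \<Rightarrow> ('a, 'p) mod_p" and f :: "('a, 'p) mod_p"
  assumes d_add: "\<And>a b. d (a + b) = d a + d b"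
    and d_mult: "\<And>a b. \<exists>z. d (a * b) - to_mod_p a * d b - to_mod_p b * d a = f * z"
    and d_const: "\<And>r. d (\<iota> r) = 0"
    and w: "w \<in> kaehler_relations \<iota>"
  shows "\<exists>z. (\<Sum>k\<in>Poly_Mapping.keys w. to_mod_p (Poly_Mapping.lookup w k) * d k) = f * z"
proof -
  define \<Phi> where "\<Phi> w = (\<Sum>k\<in>Poly_Mapping.keys w. to_mod_p (Poly_Mapping.lookup w k) * d k)" for w
  \<comment> \<open>Supports may shrink under addition and scaling, so values are compared on a
    larger finite set.\<close>
  have \<Phi>_super: "\<Phi> w = (\<Sum>k\<in>S. to_mod_p (Poly_Mapping.lookup w k) * d k)"
    if "finite S" "Poly_Mapping.keys w \<subseteq> S" for w S
    unfolding \<Phi>_def using that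
    by (intro sum.mono_neutral_left) (auto simp: in_keys_iff zero_mod_p_def[symmetric])
  have \<Phi>_add: "\<Phi> (w + z) = \<Phi> w + \<Phi> z" for w z
  proof -
    let ?S = "Poly_Mapping.keys w \<union> Poly_Mapping.keys z"
    have "\<Phi> (w + z) = (\<Sum>k\<in>?S. to_mod_p (Poly_Mapping.lookup (w + z) k) * d k)"
      by (rule \<Phi>_super) (auto dest: subsetD[OF keys_add])
    also have "\<dots> = (\<Sum>k\<in>?S. to_mod_p (Poly_Mapping.lookup w k) * d k) +
        (\<Sum>k\<in>?S. to_mod_p (Poly_Mapping.lookup z k) * d k)"
      by (simp add: lookup_add plus_mod_p.abs_eq[symmetric] distrib_right sum.distrib)
    also have "\<dots> = \<Phi> w + \<Phi> z"
      by (simp add: \<Phi>_super[of ?S])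
    finally show ?thesis .
  qed
  have \<Phi>_diff: "\<Phi> (w - z) = \<Phi> w - \<Phi> z" for w z
    using \<Phi>_add[of "w - z" z] by simp
  have \<Phi>_single: "\<Phi> (Poly_Mapping.single a c) = to_mod_p c * d a" for a c
    using \<Phi>_super[of "{a}" "Poly_Mapping.single a c"] by simp
  have \<Phi>_scale: "\<Phi> (Poly_Mapping.map ((*) c) w) = to_mod_p c * \<Phi> w" for c w
  proof -
    have "Poly_Mapping.lookup (Poly_Mapping.map ((*) c) w) k = c * Poly_Mapping.lookup w k" for k
      by (simp add: Poly_Mapping.map.rep_eq when_def in_keys_iff)
    moreover from this have "Poly_Mapping.keys (Poly_Mapping.map ((*) c) w) \<subseteq> Poly_Mapping.keys w"
      by (auto simp: in_keys_iff)
    ultimately have "\<Phi> (Poly_Mapping.map ((*) c) w) =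
        (\<Sum>k\<in>Poly_Mapping.keys w. to_mod_p (c * Poly_Mapping.lookup w k) * d k)"
      using \<Phi>_super[of "Poly_Mapping.keys w"] by simp
    then show ?thesis
      unfolding \<Phi>_def by (simp add: times_mod_p.abs_eq[symmetric] sum_distrib_left mult.assoc)
  qed
  have one: "to_mod_p 1 * y = y" for y :: "('a, 'p) mod_p"
    by (simp add: one_mod_p_def[symmetric])
  have "\<exists>z. \<Phi> w = f * z"
    using w
  proof induction
    case zero
    show ?case by (intro exI[of _ 0]) (simp add: \<Phi>_def)
  next
    case (add w z)
    then show ?case by (metis \<Phi>_add distrib_left)
  next
    case (scale w c)
    then show ?case by (metis \<Phi>_scale mult.left_commute)
  next
    case (d_add a b)
    show ?case by (intro exI[of _ 0]) (simp add: \<Phi>_diff \<Phi>_single one assms(1))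
  next
    case (d_mult a b)
    show ?case using assms(2)[of a b] by (simp add: \<Phi>_diff \<Phi>_single one)
  next
    case (d_const r)
    show ?case by (intro exI[of _ 0]) (simp add: \<Phi>_single assms(3))
  qed
  then show ?thesis by (simp add: \<Phi>_def)
qed

text \<open>The symbol of a lift u of \<omega> is a relation, while the derivation takes the value 1
  there. So 1 is a multiple of f'(\<omega>).\<close>

lemma etale_trace_nondegenerate:
  fixes \<iota> :: "'p :: prime_card padic_int \<Rightarrow> 'a :: comm_ring_1" and x \<omega> :: "('a, 'p) mod_p"
  assumes etale: "finite_etale n \<iota>"
    and basis: "is_alg_basis mod_p_scalar 3 (\<lambda>i. \<omega> ^ i)"
    and tr: "alg_trace mod_p_scalar 3 x = 0" "alg_trace mod_p_scalar 3 (x * \<omega>) = 0"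
      "alg_trace mod_p_scalar 3 (x * \<omega> ^ 2) = 0"
  shows "x = 0"
proof -
  have \<iota>: "comm_ring_hom \<iota>" and kaehler: "kaehler_relations \<iota> = UNIV"
    using etale unfolding finite_etale_def by auto
  interpret scalar_hom "mod_p_scalar :: 'p mod_ring \<Rightarrow> ('a, 'p) mod_p"
    using \<iota> by (rule scalar_hom_mod_p)
  interpret C: cubic_power_basis "mod_p_scalar :: 'p mod_ring \<Rightarrow> ('a, 'p) mod_p" \<omega>
    by standard (rule basis)
  obtain u where u: "\<omega> = to_mod_p u" using to_mod_p_surj by blast
  define d where "d y = C.der (to_mod_p y)" for y
  have "\<exists>z. (\<Sum>k\<in>Poly_Mapping.keys (dsym u). to_mod_p (Poly_Mapping.lookup (dsym u) k) * d k) = C.different * z"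
  proof (rule kaehler_relations_derivation[of d _ \<iota>])
    show "d (y + z) = d y + d z" for y z
      by (simp add: d_def to_mod_p_add C.der_add)
    show "\<exists>v. d (y * z) - to_mod_p y * d z - to_mod_p z * d y = C.different * v" for y z
      unfolding d_def to_mod_p_mult by (rule C.der_mult)
    show "d (\<iota> r) = 0" for r
      by (simp add: d_def to_mod_p_structure_map[OF \<iota>] C.lin_const C.der_lin C.lin_zero)
  qed (simp add: kaehler)
  then obtain z where "d u = C.different * z"
    by (auto simp: to_mod_p_1)
  moreover have "d u = 1"
    using C.der_lin[of 0 1 0] by (simp add: d_def flip: u C.lin_omega C.lin_one)
  ultimately show ?thesis
    using C.trace_nondegenerate tr by metis
qed


section \<open>Binomial series\<close>

lemma adic_sums_tail:
  fixes f :: "nat \<Rightarrow> 'a :: comm_ring_1"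
  assumes s: "adic_sums q f s" and tail: "\<And>m. m \<ge> N \<Longrightarrow> q ^ k dvd f m"
  shows "q ^ k dvd (\<Sum>i<N. f i) - s"
proof -
  obtain M where "\<And>n. n \<ge> M \<Longrightarrow> q ^ k dvd (\<Sum>i<n. f i) - s"
    using s unfolding adic_sums_def eventually_sequentially by blast
  then have "q ^ k dvd (\<Sum>i<max M N. f i) - s" by simp
  moreover have "q ^ k dvd (\<Sum>i<max M N. f i) - (\<Sum>i<N. f i)"
    using tail by (intro dvd_sum_diff_of_tail[of N]) auto
  ultimately show ?thesis by (rule dvd_diff_left_common[rotated])
qed

lemma padic_red_of_nat: "padic_red (of_nat n) = (of_nat n :: 'p :: prime_card mod_ring)"
  using padic_red_of_int[of "int n"] by simp

lemma padic_of_nat_unit: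
  assumes "\<not> CARD('p) dvd n"
  shows "(of_nat n :: 'p :: prime_card padic_int) dvd 1"
  using assms of_nat_0_mod_ring_dvd[of n, where 'a = 'p] by (auto simp: padic_unit_iff padic_red_of_nat)

text \<open>The extra factors p k + 1, ..., p k + j are prime to p, hence units.\<close>

lemma fact_add_dvd:
  assumes "j < CARD('p)"
  shows "(fact (CARD('p) * k + j) :: 'p :: prime_card padic_int) dvd fact (CARD('p) * k)"
  using assms
proof (induction j)
  case (Suc j)
  have "\<not> CARD('p) dvd CARD('p) * k + Suc j"
    using Suc.prems by (metis dvd_add_right_iff dvd_triv_left nat_dvd_not_less zero_less_Suc)
  then have "(of_nat (CARD('p) * k + Suc j) :: 'p padic_int) dvd 1"
    by (rule padic_of_nat_unit)
  moreover have "(fact (CARD('p) * k + Suc j) :: 'p padic_int) =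
      fact (CARD('p) * k + j) * of_nat (CARD('p) * k + Suc j)"
    by simp
  ultimately show ?case
    using Suc by (simp only: mult_unit_dvd_iff)
qed simp

text \<open>Up to units only the factors p, 2 p, ..., k p count, and their product is p^k
  k!.\<close>

lemma fact_mult_dvd:
  "(fact (CARD('p) * k) :: 'p :: prime_card padic_int) dvd padic_p ^ k * fact k"
proof (induction k)
  case (Suc k)
  define j where "j = CARD('p) - 1"
  have j: "Suc j = CARD('p)" "j < CARD('p)"
    using CARD_gt_1[where 'p = 'p] by (auto simp: j_def)
  have "CARD('p) * Suc k = Suc (CARD('p) * k + j)"
    using j by simp
  then have "(fact (CARD('p) * Suc k) :: 'p padic_int) =
      of_nat (CARD('p) * Suc k) * fact (CARD('p) * k + j)"
    by (simp only: fact_Suc)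
  also have "\<dots> dvd of_nat (CARD('p) * Suc k) * (padic_p ^ k * fact k)"
    using fact_add_dvd[OF j(2), of k] Suc by (intro mult_dvd_mono dvd_refl) (rule dvd_trans)
  also have "\<dots> = padic_p ^ Suc k * fact (Suc k)"
    by (simp add: algebra_simps)
  finally show ?case .
qed simp

text \<open>A form of Legendre's bound v(m!) \<le> (m - 1)/(p - 1). With k = m div p, the strict
  inequality survives the recursion because 4 (k + e) < 5 k \<le> m; this is where p \<ge> 5 is
  used.\<close>

lemma fact_dvd_p_power:
  assumes "CARD('p :: prime_card) \<ge> 5" "m > 0"
  shows "\<exists>e. 4 * e < m \<and> (fact m :: 'p padic_int) dvd padic_p ^ e"
  using assms(2)
proof (induction m rule: less_induct)
  case (less m)
  define k j where "k = m div CARD('p)" and "j = m mod CARD('p)"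
  have m: "m = CARD('p) * k + j" and j: "j < CARD('p)"
    using CARD_gt_1[where 'p = 'p] by (auto simp: k_def j_def)
  have dvd: "(fact m :: 'p padic_int) dvd padic_p ^ k * fact k"
    unfolding m using fact_add_dvd[OF j, of k] fact_mult_dvd by (rule dvd_trans)
  show ?case
  proof (cases "k = 0")
    case True
    with dvd less.prems show ?thesis by (intro exI[of _ 0]) simp
  next
    case False
    have 5: "5 * k \<le> m" using assms(1) unfolding m by (simp add: trans_le_add1)
    then obtain e where e: "4 * e < k" "(fact k :: 'p padic_int) dvd padic_p ^ e"
      using less.IH[of k] False by auto
    have "(fact m :: 'p padic_int) dvd padic_p ^ (k + e)"
      unfolding power_add using dvd mult_dvd_mono[OF dvd_refl e(2)] by (rule dvd_trans)
    with e 5 show ?thesis by (intro exI[of _ "k + e"]) auto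
  qed
qed

text \<open>Moving m! from the binomial coefficient to p^m leaves t only in a falling factorial, a
  polynomial with integral coefficients.\<close>

definition p_power_div_fact :: "nat \<Rightarrow> 'p :: prime_card padic_int" where
  "p_power_div_fact m = padic_p ^ m div fact m"

text \<open>From 4 e < m follows 4 (m - e) \<ge> 3 m + 1, and integrality yields k \<le> m - e
  whenever 4 k \<le> 3 m + 3. The case m = k = 3 is the sharp one needed.\<close>

lemma p_power_div_fact:
  assumes "CARD('p :: prime_card) \<ge> 5"
  shows "(padic_p :: 'p padic_int) ^ m = fact m * p_power_div_fact m"
    and "4 * k \<le> 3 * m + 3 \<Longrightarrow> m > 0 \<Longrightarrow> padic_p ^ k dvd (p_power_div_fact m :: 'p padic_int)"
proof -
  have 1: "(padic_p :: 'p padic_int) ^ m = fact m * p_power_div_fact m \<and>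
    (4 * k \<le> 3 * m + 3 \<longrightarrow> m > 0 \<longrightarrow> padic_p ^ k dvd (p_power_div_fact m :: 'p padic_int))"
  proof (cases "m = 0")
    case False
    then obtain e where e: "4 * e < m" "(fact m :: 'p padic_int) dvd padic_p ^ e"
      using fact_dvd_p_power[OF assms] by blast
    then obtain c where c: "(padic_p :: 'p padic_int) ^ e = fact m * c" by (elim dvdE)
    have m: "(padic_p :: 'p padic_int) ^ m = fact m * (c * padic_p ^ (m - e))"
      using e(1) by (simp flip: c mult.assoc power_add)
    then have "p_power_div_fact m = c * padic_p ^ (m - e)"
      by (simp add: p_power_div_fact_def)
    moreover have "k \<le> m - e" if "4 * k \<le> 3 * m + 3"
      using e(1) that by linarith
    ultimately show ?thesis
      using m by (simp add: dvd_mult le_imp_power_dvd)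
  qed (simp add: p_power_div_fact_def)
  then show "(padic_p :: 'p padic_int) ^ m = fact m * p_power_div_fact m"
    and "4 * k \<le> 3 * m + 3 \<Longrightarrow> m > 0 \<Longrightarrow> padic_p ^ k dvd (p_power_div_fact m :: 'p padic_int)"
    by blast+
qed

definition falling_poly :: "nat \<Rightarrow> 'a :: comm_ring_1 \<Rightarrow> 'a poly" where
  "falling_poly m s = (\<Prod>i<m. [:s - of_nat i, 1:])"

lemma poly_falling_poly: "poly (falling_poly m s) y = (\<Prod>i<m. s + y - of_nat i)"
  unfolding falling_poly_def by (simp add: poly_prod algebra_simps)

text \<open>Density: t agrees with an integer modulo a power of p that m! divides, polynomials
  respect congruences, and for integers the quotient is a binomial coefficient. This makes the
  division in \<open>padic_binom\<close> exact.\<close>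

lemma fact_dvd_falling:
  fixes t :: "'p :: prime_card padic_int"
  shows "fact m dvd (\<Prod>i<m. t - of_nat i)"
proof -
  obtain K where K: "(fact m :: 'p padic_int) dvd padic_p ^ K"
    using padic_dvd_p_power[of "fact m"] by auto
  define a where "a = padic_nth t K"
  have "padic_p ^ K dvd t - of_int a"
    unfolding padic_nth_eq_iff a_def by (simp add: padic_nth_of_int padic_nth_range)
  then have "fact m dvd t - of_int a" using K dvd_trans by blast
  then have "fact m dvd poly (falling_poly m 0) t - poly (falling_poly m 0) (of_int a)"
    using dvd_poly_diff dvd_trans by blast
  moreover have "fact m dvd poly (falling_poly m 0) (of_int a :: 'p padic_int)"
  proof -
    obtain z where z: "(\<Prod>i<m. a - int i) = fact m * z"
      by (rule that[OF gbinomial_int_mult_fact[of m a, unfolded atLeast0LessThan, symmetric]])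
    have "poly (falling_poly m 0) (of_int a :: 'p padic_int) = of_int (\<Prod>i<m. a - int i)"
      unfolding poly_falling_poly by simp
    then show ?thesis unfolding z by simp
  qed
  ultimately have "fact m dvd poly (falling_poly m 0) t
      - poly (falling_poly m 0) (of_int a) + poly (falling_poly m 0) (of_int a)"
    by (rule dvd_add)
  then show ?thesis by (simp add: poly_falling_poly)
qed

lemma p_power_padic_binom:
  fixes t :: "'p :: prime_card padic_int"
  assumes "CARD('p) \<ge> 5"
  shows "padic_p ^ m * padic_binom t m = p_power_div_fact m * (\<Prod>i<m. t - of_nat i)"
proof -
  have "(\<Prod>i<m. t - of_nat i) = fact m * padic_binom t m"
    unfolding padic_binom_def using fact_dvd_falling[of m t] by (auto elim!: dvdE)
  then show ?thesis
    unfolding p_power_div_fact(1)[OF assms] by (simp add: mult_ac)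
qed

text \<open>The double series is rearranged by powers of y. The factors p^m / m! tend to 0
  independently of the degree n and of y, so the same partial sum approximates the coefficients and
  the values.\<close>

lemma binomial_series_expansion:
  fixes F :: "'p :: prime_card padic_int \<Rightarrow> 'p padic_int"
  assumes p5: "CARD('p) \<ge> 5"
    and F: "\<And>t. adic_sums padic_p (\<lambda>m. \<tau> m * (padic_p ^ m * padic_binom t m)) (F t)"
  obtains g where "restricted g" "\<And>y. F (s + y) = restricted_eval g y"
    "fps_const (padic_p ^ 3) dvd g - fps_of_poly (\<Sum>m<3. smult (\<tau> m * p_power_div_fact m) (falling_poly m s))"
proof -
  let ?c = "\<lambda>m. \<tau> m * p_power_div_fact m"
  let ?R = "\<lambda>N. \<Sum>m<N. smult (?c m) (falling_poly m s)"
  have F': "adic_sums padic_p (\<lambda>m. ?c m * (\<Prod>i<m. t - of_nat i)) (F t)" for t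
    using F[of t] by (simp add: p_power_padic_binom[OF p5] mult.assoc)
  have c_dvd: "padic_p ^ k dvd ?c m" if "4 * k \<le> 3 * m + 3" "m > 0" for k m
    using p_power_div_fact(2)[OF p5 that] by (rule dvd_mult)
  \<comment> \<open>A cruder bound that tends to infinity with m and also covers k = 0.\<close>
  have c_dvd': "padic_p ^ k dvd ?c m" if "2 * k \<le> m" for k m
    using c_dvd[of k m] that by (cases "k = 0") auto
  have "\<exists>l. adic_sums padic_p (\<lambda>m. ?c m * coeff (falling_poly m s) n) l" for n
    by (rule adic_summable[OF adic_complete_padic, where N = "\<lambda>k. 2 * k"
          and f = "\<lambda>m. ?c m * coeff (falling_poly m s) n"]) (blast intro: dvd_mult2 c_dvd')+
  then obtain l where l: "\<And>n. adic_sums padic_p (\<lambda>m. ?c m * coeff (falling_poly m s) n) (l n)"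
    by metis
  define g where "g = Abs_fps l"
  have approx: "fps_const (padic_p ^ k) dvd g - fps_of_poly (?R N)"
    "padic_p ^ k dvd F (s + y) - poly (?R N) y"
    if "\<And>m. m \<ge> N \<Longrightarrow> padic_p ^ k dvd ?c m" for k N y
  proof -
    show "fps_const (padic_p ^ k) dvd g - fps_of_poly (?R N)"
      unfolding fps_const_dvd_iff
    proof
      fix n
      have "padic_p ^ k dvd (\<Sum>m<N. ?c m * coeff (falling_poly m s) n) - l n"
        by (rule adic_sums_tail[OF l]) (simp add: that dvd_mult2)
      then show "padic_p ^ k dvd fps_nth (g - fps_of_poly (?R N)) n"
        by (simp add: g_def coeff_sum dvd_diff_sym)
    qed
    have "padic_p ^ k dvd (\<Sum>m<N. ?c m * (\<Prod>i<m. s + y - of_nat i)) - F (s + y)"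
      by (rule adic_sums_tail[OF F']) (simp add: that dvd_mult2)
    then show "padic_p ^ k dvd F (s + y) - poly (?R N) y"
      by (simp add: poly_sum poly_falling_poly dvd_diff_sym)
  qed
  show thesis
  proof
    show "restricted g"
      unfolding restricted_iff using approx(1)[OF c_dvd'] by blast
    show "F (s + y) = restricted_eval g y" for y
      by (rule restricted_eval_eqI[symmetric]) (use approx[OF c_dvd'] in blast)
    show "fps_const (padic_p ^ 3) dvd g - fps_of_poly (?R 3)"
      by (rule approx(1)) (simp add: c_dvd)
  qed
qed

text \<open>The trace is linear and respects divisibility by powers of p, so it passes through the
  series term by term.\<close>

lemma adic_sums_trace_adic_pow:
  fixes \<iota> :: "'p :: prime_card padic_int \<Rightarrow> 'a :: comm_ring_1"
  assumes \<iota>: "comm_ring_hom \<iota>" and b: "is_alg_basis \<iota> n b"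
  shows "adic_sums padic_p (\<lambda>m. alg_trace \<iota> n (y * U ^ m) * (padic_p ^ m * padic_binom t m))
    (alg_trace \<iota> n (y * adic_pow \<iota> (1 + of_nat CARD('p) * U) t))"
proof -
  interpret \<iota>: comm_ring_hom \<iota> by (rule \<iota>)
  interpret S: scalar_hom \<iota> using \<iota> by (rule scalar_hom_comm_ring_hom)
  let ?q = "of_nat CARD('p) :: 'a"
  let ?f = "\<lambda>m. \<iota> (padic_binom t m) * (?q * U) ^ m"
  have dvd: "?q ^ k dvd ?f m" if "m \<ge> k" for k m
    using that by (simp add: power_mult_distrib le_imp_power_dvd dvd_mult dvd_mult2)
  obtain s where s: "adic_sums ?q ?f s" "\<And>k N. N \<ge> k \<Longrightarrow> ?q ^ k dvd (\<Sum>i<N. ?f i) - s"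
    by (rule adic_summable[OF adic_complete_alg[OF \<iota> b], of "\<lambda>k. k" ?f]) (blast intro: dvd that)+
  have pow: "adic_pow \<iota> (1 + ?q * U) t = s"
    unfolding adic_pow_def using adic_complete_alg[OF \<iota> b] s(1)
    by (simp add: adic_complete_def adic_suminf_eq)
  have "padic_p ^ k dvd (\<Sum>m<N. alg_trace \<iota> n (y * U ^ m) * (padic_p ^ m * padic_binom t m))
      - alg_trace \<iota> n (y * s)" if "N \<ge> k" for k N
  proof -
    have "y * (\<Sum>i<N. ?f i) = (\<Sum>m<N. \<iota> (padic_p ^ m * padic_binom t m) * (y * U ^ m))"
      by (simp add: sum_distrib_left power_mult_distrib \<iota>.hom_mult \<iota>.hom_power \<iota>.hom_of_nat mult_ac)
    then have "alg_trace \<iota> n (y * ((\<Sum>i<N. ?f i) - s)) =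
        (\<Sum>m<N. alg_trace \<iota> n (y * U ^ m) * (padic_p ^ m * padic_binom t m)) - alg_trace \<iota> n (y * s)"
      unfolding right_diff_distrib S.alg_trace_diff[OF b]
      by (simp only: S.alg_trace_sum[OF b]) (simp add: mult.commute)
    moreover have "?q ^ k dvd y * ((\<Sum>i<N. ?f i) - s)"
      using s(2)[OF that] by (rule dvd_mult)
    ultimately show ?thesis
      using p_power_dvd_alg_trace[OF \<iota> b] by metis
  qed
  then show ?thesis
    unfolding pow by (rule adic_sumsI)
qed


section \<open>Zeros of a function with quadratic reduction\<close>

text \<open>Fractions outside Z_p have an inverse in p Z_p.\<close>

lemma padic_fract_cases:
  fixes z :: "'p :: prime_card padic_int fract"
  obtains y where "z = to_fract y" | w where "z * to_fract (padic_p * w) = 1"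
proof -
  obtain a b where z: "z = Fract a b" "b \<noteq> 0" by (cases z)
  consider "b dvd a" | "padic_p * a dvd b" using padic_dvd_linear by blast
  then show thesis
  proof cases
    case 1
    then obtain k where "a = b * k" by (elim dvdE)
    then have "z = to_fract k" using z by (simp add: Fract_conv_to_fract)
    then show thesis by (rule that)
  next
    case 2
    then obtain w where w: "b = padic_p * a * w" by (elim dvdE)
    have "z * to_fract (padic_p * w) = to_fract b / to_fract b"
      by (simp add: z Fract_conv_to_fract w)
    then have "z * to_fract (padic_p * w) = 1" using z by simp
    then show thesis by (rule that)
  qed
qed

text \<open>Integral closedness by hand: if z (p w) = 1, multiplying the equation by (p w)^2 makes 1
  divisible by p. It serves both for roots of W and for square roots of the discriminant.\<close>

lemma padic_quadratic_integral:
  fixes z :: "'p :: prime_card padic_int fract"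
  assumes "z ^ 2 + to_fract b * z + to_fract c = 0"
  obtains y where "z = to_fract y" "y ^ 2 + b * y + c = 0"
proof (rule padic_fract_cases[of z])
  fix y assume y: "z = to_fract y"
  then have "to_fract (y ^ 2 + b * y + c) = 0"
    using assms by (simp add: power2_eq_square)
  then have "y ^ 2 + b * y + c = 0" by (simp only: to_fract_eq_0_iff)
  with y show thesis by (rule that)
next
  fix w assume w: "z * to_fract (padic_p * w) = 1"
  let ?u = "to_fract (padic_p * w)"
  have "0 = (z ^ 2 + to_fract b * z + to_fract c) * ?u ^ 2"
    using assms by simp
  also have "\<dots> = (z * ?u) ^ 2 + to_fract b * ((z * ?u) * ?u) + to_fract c * ?u ^ 2"
    by (simp only: power2_eq_square algebra_simps)
  also have "\<dots> = to_fract (1 + b * (padic_p * w) + c * (padic_p * w) ^ 2)"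
    unfolding w by (simp add: power2_eq_square)
  finally have "1 + b * (padic_p * w) + c * (padic_p * w) ^ 2 = 0"
    by (metis to_fract_eq_0_iff)
  then have "1 = padic_p * (- (b * w) - c * w * (padic_p * w))"
    by (simp add: algebra_simps power2_eq_square eq_neg_iff_add_eq_0)
  then have "padic_p dvd (1 :: 'p padic_int)" by (rule dvdI)
  then show thesis
    by (simp add: padic_unit_iff padic_red_p)
qed

lemma order_eq_1_imp:
  fixes Q :: "'a :: idom poly"
  assumes "order r Q = 1"
  shows "poly Q r = 0" "Q \<noteq> 0 \<Longrightarrow> poly (pderiv Q) r \<noteq> 0"
proof -
  show "poly Q r = 0" using assms order_root by force
  assume "Q \<noteq> 0"
  then obtain R where "Q = [:-r, 1:] * R" "\<not> [:-r, 1:] dvd R"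
    using order_decomp[of Q r] assms by auto
  then show "poly (pderiv Q) r \<noteq> 0"
    by (simp add: poly_eq_0_iff_dvd pderiv_mult pderiv_pCons del: mult_pCons_left)
qed

lemma order_eq_2_imp:
  fixes Q :: "'a :: idom poly"
  assumes "order r Q = 2"
  shows "poly Q r = 0" "poly (pderiv Q) r = 0"
proof -
  obtain R where R: "Q = [:-r, 1:] ^ 2 * R"
    using order_1[of r Q] assms by (auto elim: dvdE)
  show "poly Q r = 0" "poly (pderiv Q) r = 0"
    unfolding R power2_eq_square by (simp_all add: pderiv_mult pderiv_pCons del: mult_pCons_left)
qed

lemma mem_residue_disk_iff:
  assumes "padic_red s = r"
  shows "t \<in> residue_disk r \<longleftrightarrow> padic_p dvd t - s"
  by (simp only: residue_disk_eq mem_Collect_eq padic_red_eq_iff[symmetric] assms)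

lemma residue_disk_Collect_eq: "{t \<in> residue_disk r. R t} = {least_rep r + y | y. padic_p dvd y \<and> R (least_rep r + y)}"
proof -
  have "t \<in> residue_disk r \<longleftrightarrow> (\<exists>y. padic_p dvd y \<and> t = least_rep r + y)" for t
  proof
    assume "t \<in> residue_disk r"
    then show "\<exists>y. padic_p dvd y \<and> t = least_rep r + y"
      by (intro exI[of _ "t - least_rep r"]) (simp add: mem_residue_disk_iff[OF padic_red_least_rep])
  qed (auto simp: mem_residue_disk_iff[OF padic_red_least_rep])
  then show ?thesis by auto
qed

text \<open>Modulo p the series H is the Taylor expansion of Q at s, with d its quadratic
  coefficient. It is required at every centre because multiplicities are read at the zeros, not at
  the least representatives.\<close>

locale quadratic_reduction =
  fixes F :: "'p :: prime_card padic_int \<Rightarrow> 'p padic_int"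
    and Q :: "'p mod_ring poly" and d :: "'p mod_ring"
  assumes two_unit: "(2 :: 'p padic_int) dvd 1"
    and Q_nz: "Q \<noteq> 0" and d_nz: "d \<noteq> 0"
    and expansion: "\<exists>H. restricted H \<and> (\<forall>y. F (s + y) = padic_p ^ 2 * restricted_eval H y) \<and>
      padic_red (fps_nth H 0) = poly Q (padic_red s) \<and>
      padic_red (fps_nth H 1) = poly (pderiv Q) (padic_red s) \<and>
      padic_red (fps_nth H 2) = d \<and> (\<forall>n\<ge>3. padic_red (fps_nth H n) = 0)"
begin

lemma expansion_unique:
  assumes "restricted H" "restricted H'"
    and "\<And>y. F (s + y) = padic_p ^ 2 * restricted_eval H y"
    and "\<And>y. F (s + y) = padic_p ^ 2 * restricted_eval H' y"
  shows "H = H'"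
proof (rule restricted_eqI[OF assms(1,2)])
  fix y
  have "padic_p ^ 2 * restricted_eval H y = padic_p ^ 2 * restricted_eval H' y"
    using assms(3,4) by metis
  then show "restricted_eval H y = restricted_eval H' y" by simp
qed

lemma F_eq_p_square_mult:
  obtains x where "F t = padic_p ^ 2 * x" "padic_red x = poly Q (padic_red t)"
proof -
  obtain H where "restricted H" "\<forall>y. F (t + y) = padic_p ^ 2 * restricted_eval H y"
    "padic_red (fps_nth H 0) = poly Q (padic_red t)"
    using expansion[of t] by blast
  moreover from this(2) have "F (t + 0) = padic_p ^ 2 * restricted_eval H 0" by blast
  ultimately show thesis
    using that[of "fps_nth H 0"] by (simp add: restricted_eval_0_right)
qed

lemma F_div_p_square:
  "padic_p ^ 2 dvd F t" "padic_red (F t div padic_p ^ 2) = poly Q (padic_red t)"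
proof -
  obtain x where "F t = padic_p ^ 2 * x" "padic_red x = poly Q (padic_red t)"
    by (rule F_eq_p_square_mult)
  then show "padic_p ^ 2 dvd F t" "padic_red (F t div padic_p ^ 2) = poly Q (padic_red t)"
    by simp_all
qed

lemma p_cubed_dvd_F_iff: "padic_p ^ 3 dvd F t \<longleftrightarrow> poly Q (padic_red t) = 0"
proof -
  obtain x where x: "F t = padic_p ^ 2 * x" "padic_red x = poly Q (padic_red t)"
    by (rule F_eq_p_square_mult)
  have "(padic_p :: 'p padic_int) ^ 3 = padic_p ^ 2 * padic_p"
    by (simp add: eval_nat_numeral)
  then show ?thesis
    by (simp add: x(1) padic_red_eq_0_iff flip: x(2))
qed

text \<open>On the disk the difference quotient of H is Q'(r) modulo p, hence a unit. Uniqueness of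
  the zero and the valuation formula are both consequences.\<close>

lemma simple_root_diff:
  assumes r: "order r Q = 1" and t: "t \<in> residue_disk r" "t' \<in> residue_disk r"
  obtains u where "u dvd 1" "F t - F t' = padic_p ^ 2 * ((t - t') * u)"
proof -
  define s where "s = least_rep r"
  have s: "padic_red s = r" by (simp add: s_def padic_red_least_rep)
  obtain H where H: "restricted H" "\<And>y. F (s + y) = padic_p ^ 2 * restricted_eval H y"
    "padic_red (fps_nth H 1) = poly (pderiv Q) r"
    using expansion[of s] s by blast
  define y y' where "y = t - s" and "y' = t' - s"
  have y: "padic_p dvd y" "padic_p dvd y'" "t = s + y" "t' = s + y'" "t - t' = y - y'"
    using t mem_residue_disk_iff[OF s] by (auto simp: y_def y'_def)
  obtain w where "restricted_eval H y - restricted_eval H y' - fps_nth H 1 * (y - y') =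
      padic_p * (y - y') * w"
    using restricted_eval_diff_approx[OF H(1) y(1,2)] by (elim dvdE)
  then have "restricted_eval H y - restricted_eval H y' = (y - y') * (fps_nth H 1 + padic_p * w)"
    by (simp add: algebra_simps)
  then have "F t - F t' = padic_p ^ 2 * ((t - t') * (fps_nth H 1 + padic_p * w))"
    unfolding y(3-5) H(2) by (simp flip: right_diff_distrib)
  moreover have "fps_nth H 1 + padic_p * w dvd 1"
    using order_eq_1_imp(2)[OF r Q_nz] H(3)
    by (simp add: padic_unit_iff padic_red_add padic_red_mult padic_red_p)
  ultimately show thesis using that by blast
qed

text \<open>Newton's iteration with the slope frozen at the centre, in the rescaled coordinate z
  with y = p z.\<close>

lemma simple_root_exists:
  assumes r: "order r Q = 1"
  obtains \<tau> where "\<tau> \<in> residue_disk r" "F \<tau> = 0"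
proof -
  define s where "s = least_rep r"
  have s: "padic_red s = r" by (simp add: s_def padic_red_least_rep)
  obtain H where H: "restricted H" "\<And>y. F (s + y) = padic_p ^ 2 * restricted_eval H y"
    "padic_red (fps_nth H 0) = poly Q r" "padic_red (fps_nth H 1) = poly (pderiv Q) r"
    using expansion[of s] s by blast
  have "fps_nth H 1 dvd 1"
    using order_eq_1_imp(2)[OF r Q_nz] H(4) by (simp add: padic_unit_iff)
  then obtain v where v: "fps_nth H 1 * v = 1" by (metis dvdE)
  have "padic_p dvd restricted_eval H (padic_p * z)" for z
  proof -
    have "padic_p dvd fps_nth H 0"
      using order_eq_1_imp(1)[OF r] H(3) by (simp flip: padic_red_eq_0_iff)
    moreover have "padic_p * z dvd restricted_eval H (padic_p * z) - fps_nth H 0"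
      using restricted_eval_diff[OF H(1), of "padic_p * z" 0]
      by (simp add: restricted_eval_0_right[OF H(1)])
    then have "padic_p dvd restricted_eval H (padic_p * z) - fps_nth H 0"
      by (rule dvd_mult_left)
    ultimately have "padic_p dvd fps_nth H 0 + (restricted_eval H (padic_p * z) - fps_nth H 0)"
      by (rule dvd_add)
    then show ?thesis by simp
  qed
  \<comment> \<open>e z is H(p z) / p; dividing by p here is what keeps the iteration inside the
    disk.\<close>
  then have "\<exists>e. restricted_eval H (padic_p * z) = padic_p * e" for z by (auto elim: dvdE)
  then obtain e where e: "\<And>z. restricted_eval H (padic_p * z) = padic_p * e z" by metis
  obtain z where "z - v * e z = z"
  proof (rule adic_contraction_fixpoint[OF adic_complete_padic, where S = "\<lambda>_. True"
        and \<Phi> = "\<lambda>z. z - v * e z" and ?x0.0 = 0])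
    fix x y :: "'p padic_int" and k
    assume xy: "padic_p ^ k dvd x - y"
    obtain w where "restricted_eval H (padic_p * x) - restricted_eval H (padic_p * y)
        - fps_nth H 1 * (padic_p * x - padic_p * y) = padic_p * (padic_p * x - padic_p * y) * w"
      using restricted_eval_diff_approx[OF H(1), of "padic_p * x" "padic_p * y"]
      by (auto elim!: dvdE)
    then have "padic_p * (e x - e y) = padic_p * (fps_nth H 1 * (x - y) + padic_p * (x - y) * w)"
      unfolding e by (simp add: algebra_simps)
    then have "e x - e y = fps_nth H 1 * (x - y) + padic_p * (x - y) * w"
      by simp
    then have "v * (e x - e y) = v * (fps_nth H 1 * (x - y) + padic_p * (x - y) * w)"
      by (rule arg_cong)
    also have "\<dots> = (fps_nth H 1 * v) * (x - y) + padic_p * (x - y) * (v * w)"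
      by (simp add: algebra_simps)
    finally have "(x - v * e x) - (y - v * e y) = - (padic_p * (x - y) * (v * w))"
      unfolding v by (simp add: algebra_simps)
    moreover have "padic_p * padic_p ^ k dvd padic_p * (x - y) * (v * w)"
      using xy by (intro dvd_mult2 mult_dvd_mono dvd_refl)
    ultimately show "padic_p ^ Suc k dvd x - v * e x - (y - v * e y)"
      by (simp only: dvd_minus_iff power_Suc)
  qed auto
  then have "v * e z = 0" by simp
  with v have "e z = 0" by auto
  then have "F (s + padic_p * z) = 0" by (simp add: H(2) e)
  moreover have "s + padic_p * z \<in> residue_disk r"
    by (simp add: mem_residue_disk_iff[OF s])
  ultimately show thesis using that by blast
qed

lemma simple_root:
  assumes r: "order r Q = 1"
  shows "\<exists>!\<tau>. \<tau> \<in> residue_disk r \<and> F \<tau> = 0"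
    and "\<tau> \<in> residue_disk r \<Longrightarrow> F \<tau> = 0 \<Longrightarrow> t \<in> residue_disk r \<Longrightarrow>
      padic_val (F t) = 2 + padic_val (t - \<tau>)"
proof -
  obtain \<tau> where \<tau>: "\<tau> \<in> residue_disk r" "F \<tau> = 0"
    using r by (rule simple_root_exists)
  show "\<exists>!\<tau>. \<tau> \<in> residue_disk r \<and> F \<tau> = 0"
  proof (rule ex1I[of _ \<tau>])
    fix t assume "t \<in> residue_disk r \<and> F t = 0"
    moreover obtain u where "u dvd 1" "F t - F \<tau> = padic_p ^ 2 * ((t - \<tau>) * u)"
      using r \<open>t \<in> residue_disk r \<and> F t = 0\<close> \<tau> by (metis simple_root_diff)
    ultimately show "t = \<tau>" using \<tau> by auto
  qed (use \<tau> in blast)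
next
  assume \<tau>: "\<tau> \<in> residue_disk r" "F \<tau> = 0" and t: "t \<in> residue_disk r"
  obtain u where "u dvd 1" "F t - F \<tau> = padic_p ^ 2 * ((t - \<tau>) * u)"
    using r t \<tau>(1) by (rule simple_root_diff)
  then show "padic_val (F t) = 2 + padic_val (t - \<tau>)"
    using padic_val_mult_p_power_unit[of u 2 "t - \<tau>"] \<tau>(2) by (simp add: numeral_eq_enat)
qed

lemma expansion_ex1:
  "\<exists>!H. restricted H \<and> (\<forall>y. F (s + y) = padic_p ^ 2 * restricted_eval H y)"
proof -
  obtain H where "restricted H" "\<forall>y. F (s + y) = padic_p ^ 2 * restricted_eval H y"
    using expansion[of s] by blast
  then show ?thesis
    using expansion_unique[of _ H s] by (intro ex1I[of _ H]) simp_all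
qed

text \<open>Q(r) = Q'(r) = 0 removes the coefficients 0 and 1 modulo p, and those from 3 on vanish
  there anyway. Only the unit coefficient d remains, so preparation applies in degree 2.\<close>

lemma double_root_weierstrass:
  assumes r: "order r Q = 2" and H: "restricted H"
    and FH: "\<And>y. F (least_rep r + y) = padic_p ^ 2 * restricted_eval H y"
  shows "\<exists>!W. distinguished W \<and> degree W = 2 \<and> (\<exists>V. restricted_unit V \<and> H = fps_of_poly W * V)"
proof -
  obtain H' where H': "restricted H'" "\<And>y. F (least_rep r + y) = padic_p ^ 2 * restricted_eval H' y"
      "padic_red (fps_nth H' 0) = poly Q r" "padic_red (fps_nth H' 1) = poly (pderiv Q) r"
      "padic_red (fps_nth H' 2) = d" "\<And>n. n \<ge> 3 \<Longrightarrow> padic_red (fps_nth H' n) = 0"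
    using expansion[of "least_rep r"] unfolding padic_red_least_rep by blast
  have "H' = H" using H'(1) H H'(2) FH by (rule expansion_unique)
  have "fps_nth H 2 dvd 1"
    using H'(5) d_nz by (simp add: \<open>H' = H\<close> padic_unit_iff)
  moreover have "padic_p dvd fps_nth H n" if "n \<noteq> 2" for n
  proof -
    consider "n = 0" | "n = 1" | "n \<ge> 3" using \<open>n \<noteq> 2\<close> by linarith
    then show ?thesis
      using H'(3,4,6) order_eq_2_imp[OF r]
      by cases (auto simp: \<open>H' = H\<close> simp flip: padic_red_eq_0_iff)
  qed
  ultimately obtain W V where "distinguished W" "degree W = 2" "restricted_unit V" "H = fps_of_poly W * V"
    using H weierstrass_preparation[of H 2] by blast
  then show ?thesis
    using weierstrass_factor_unique by (intro ex1I[of _ W]) blast+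
qed

text \<open>The series at \<tau> comes from the expansion centred at \<tau>, so the series around
  the least representative need not be recentred and D may be a mere function.\<close>

lemma zero_of_multI:
  assumes "\<And>y. F (\<tau> + y) = y ^ m * D y" "\<And>y. y dvd D y - D 0" "D 0 \<noteq> 0"
  shows "zero_of_mult F \<tau> m"
proof -
  obtain H where H: "restricted H" "\<And>y. F (\<tau> + y) = padic_p ^ 2 * restricted_eval H y"
    using expansion[of \<tau>] by blast
  define g where "g = fps_const (padic_p ^ 2) * H"
  have g: "restricted g" "\<And>y. F (\<tau> + y) = restricted_eval g y"
    unfolding g_def H(2) using H(1)
    by (simp_all add: restricted_mult restricted_const restricted_eval_mult restricted_eval_const del: fps_const_power)
  have "g \<noteq> 0 \<and> subdegree g = m"
    by (rule restricted_subdegree_eqI[OF g(1) _ assms(2,3)]) (simp flip: g(2) add: assms(1))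
  with g show ?thesis unfolding zero_of_mult_def by blast
qed

section \<open>Zeros in the disk of a double root, read off from its Weierstrass quadratic\<close>

context
  fixes r b c W V H
  assumes H: "restricted H" "\<And>y. F (least_rep r + y) = padic_p ^ 2 * restricted_eval H y"
    and W: "W = [:c, b, 1:]" "padic_p dvd b" "padic_p dvd c"
    and V: "restricted_unit V" "H = fps_of_poly W * V"
begin

lemma F_factor: "F (least_rep r + y) = padic_p ^ 2 * (poly W y * restricted_eval V y)"
proof -
  have "restricted V" using V(1) unfolding restricted_unit_def by blast
  then show ?thesis
    unfolding H(2) V(2)
    by (simp add: restricted_eval_mult restricted_fps_of_poly restricted_eval_fps_of_poly)
qed

lemma F_eq_0_iff: "F (least_rep r + y) = 0 \<longleftrightarrow> poly W y = 0"
  using restricted_unit_eval[OF V(1), of y] by (auto simp: F_factor)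

lemma poly_W: "poly W y = y ^ 2 + b * y + c"
  by (simp add: W(1) power2_eq_square algebra_simps)

lemma poly_W_fract: "poly (map_poly to_fract W) z = z ^ 2 + to_fract b * z + to_fract c"
  by (simp add: W(1) map_poly_pCons power2_eq_square algebra_simps)

lemma p_dvd_root:
  assumes "poly W y = 0"
  shows "padic_p dvd y"
proof -
  have "y ^ 2 = - (b * y + c)"
    using assms unfolding poly_W by (simp only: eq_neg_iff_add_eq_0 add.assoc)
  then have "padic_p dvd y ^ 2" using W by (simp add: dvd_mult2)
  then show ?thesis by (rule padic_prime_dvd_square)
qed

lemma fract_root_iff:
  "poly (map_poly to_fract W) z = 0 \<longleftrightarrow> (\<exists>y. z = to_fract y \<and> poly W y = 0)"
proof
  assume "poly (map_poly to_fract W) z = 0"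
  then obtain y where "z = to_fract y" "y ^ 2 + b * y + c = 0"
    unfolding poly_W_fract by (rule padic_quadratic_integral)
  then show "\<exists>y. z = to_fract y \<and> poly W y = 0" by (auto simp: poly_W)
next
  assume "\<exists>y. z = to_fract y \<and> poly W y = 0"
  then obtain y where y: "z = to_fract y" "poly W y = 0" by blast
  have "poly (map_poly to_fract W) z = to_fract (poly W y)"
    unfolding poly_W_fract y(1) poly_W by (simp add: power2_eq_square)
  with y show "poly (map_poly to_fract W) z = 0" by simp
qed

lemma zeros_eq: "{t \<in> residue_disk r. F t = 0} = (\<lambda>y. least_rep r + y) ` {y. poly W y = 0}"
  unfolding residue_disk_Collect_eq F_eq_0_iff using p_dvd_root by blast

lemma zeros_bij_roots:
  "bij_betw (\<lambda>t. to_fract (t - least_rep r)) {t \<in> residue_disk r. F t = 0}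
     {z. poly (map_poly to_fract W) z = 0}"
  unfolding zeros_eq bij_betw_def
  by (auto simp: inj_on_def image_image fract_root_iff)

lemma p_power_dvd_F:
  assumes "k \<ge> 3"
  shows "{t \<in> residue_disk r. padic_p ^ k dvd F t} =
    {least_rep r + y | y. padic_p dvd y \<and> padic_p ^ (k - 2) dvd poly W y}"
proof -
  have "padic_p ^ k dvd F (least_rep r + y) \<longleftrightarrow> padic_p ^ (k - 2) dvd poly W y" for y
  proof -
    have "k = 2 + (k - 2)" using assms by simp
    then have "(padic_p :: 'p padic_int) ^ k = padic_p ^ 2 * padic_p ^ (k - 2)"
      by (metis power_add)
    then show ?thesis
      using restricted_unit_eval[OF V(1), of y] by (simp add: F_factor dvd_mult_unit_iff)
  qed
  then show ?thesis unfolding residue_disk_Collect_eq by simp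
qed

text \<open>Used with m = 1 and e the difference of the two roots. The cofactor at the zero is p^2 e
  times a unit.\<close>

lemma zero_of_mult_factored:
  assumes W_eq: "\<And>y. poly W (y0 + y) = y ^ m * (y + e)" and "e \<noteq> 0"
  shows "zero_of_mult F (least_rep r + y0) m"
proof (rule zero_of_multI)
  have V': "restricted V" using V(1) unfolding restricted_unit_def by blast
  define D where "D y = padic_p ^ 2 * ((y + e) * restricted_eval V (y0 + y))" for y
  show "F (least_rep r + y0 + y) = y ^ m * D y" for y
    using F_factor[of "y0 + y"] by (simp add: D_def W_eq add.assoc mult_ac)
  show "y dvd D y - D 0" for y
  proof -
    have "D y - D 0 = padic_p ^ 2 * (y * restricted_eval V (y0 + y)
        + e * (restricted_eval V (y0 + y) - restricted_eval V y0))"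
      by (simp add: D_def algebra_simps)
    moreover have "y dvd restricted_eval V (y0 + y) - restricted_eval V y0"
      using restricted_eval_diff[OF V', of "y0 + y" y0] by simp
    ultimately show ?thesis by simp
  qed
  show "D 0 \<noteq> 0"
    using restricted_unit_eval[OF V(1), of y0] assms(2) by (auto simp: D_def)
qed

lemma zero_of_mult_double:
  assumes W_eq: "\<And>y. poly W (y0 + y) = y ^ 2"
  shows "zero_of_mult F (least_rep r + y0) 2"
proof (rule zero_of_multI)
  have V': "restricted V" using V(1) unfolding restricted_unit_def by blast
  define D where "D y = padic_p ^ 2 * restricted_eval V (y0 + y)" for y
  show "F (least_rep r + y0 + y) = y ^ 2 * D y" for y
    using F_factor[of "y0 + y"] by (simp add: D_def W_eq add.assoc mult_ac)
  show "y dvd D y - D 0" for y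
    using restricted_eval_diff[OF V', of "y0 + y" y0]
    by (simp add: D_def dvd_mult flip: right_diff_distrib)
  show "D 0 \<noteq> 0"
    using restricted_unit_eval[OF V(1), of y0] by (auto simp: D_def)
qed

lemma zeros_nonsquare_discriminant:
  assumes "\<nexists>s. s ^ 2 = to_fract (b ^ 2 - 4 * c)"
  shows "{t \<in> residue_disk r. F t = 0} = {}"
proof -
  have "poly W y \<noteq> 0" for y
  proof
    assume y: "poly W y = 0"
    \<comment> \<open>Completing the square: a root would exhibit a square root of the
      discriminant.\<close>
    have "(2 * y + b) ^ 2 = 4 * poly W y + (b ^ 2 - 4 * c)"
      unfolding poly_W by (simp add: power2_eq_square algebra_simps)
    then have "to_fract (2 * y + b) ^ 2 = to_fract (b ^ 2 - 4 * c)"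
      unfolding y by (metis add_0 mult_zero_right power2_eq_square to_fract_mult)
    with assms show False by blast
  qed
  then show ?thesis unfolding zeros_eq by simp
qed

text \<open>The quadratic formula, integral because 2 is a unit. \<sigma> = 0 is allowed, which
  covers the double zero as well.\<close>

lemma zeros_square_discriminant:
  assumes \<sigma>: "\<sigma> ^ 2 = b ^ 2 - 4 * c"
  obtains y1 y2 where "\<forall>y. poly W y = (y - y1) * (y - y2)" "y1 - y2 = \<sigma>"
    "{t \<in> residue_disk r. F t = 0} = {least_rep r + y1, least_rep r + y2}"
proof -
  obtain h :: "'p padic_int" where h: "2 * h = 1" using two_unit by (metis dvdE)
  define y1 y2 where "y1 = (\<sigma> - b) * h" and "y2 = (- \<sigma> - b) * h"
  have "(2 * h) * (2 * h) = 1" using h by simp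
  then have h4: "4 * (h * h) = 1" by (simp add: algebra_simps)
  have sum: "y1 + y2 = - b"
  proof -
    have "y1 + y2 = - b * (2 * h)" by (simp add: y1_def y2_def algebra_simps)
    then show ?thesis using h by simp
  qed
  have prod: "y1 * y2 = c"
  proof -
    have "y1 * y2 = (b ^ 2 - \<sigma> ^ 2) * (h * h)"
      by (simp add: y1_def y2_def power2_eq_square algebra_simps)
    also have "\<dots> = c * (4 * (h * h))" by (simp add: \<sigma>)
    finally show ?thesis using h4 by simp
  qed
  have factor: "\<forall>y. poly W y = (y - y1) * (y - y2)"
  proof
    fix y
    have "(y - y1) * (y - y2) = y ^ 2 - (y1 + y2) * y + y1 * y2"
      by (simp add: power2_eq_square algebra_simps)
    then show "poly W y = (y - y1) * (y - y2)" unfolding sum prod poly_W by simp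
  qed
  moreover have "y1 - y2 = \<sigma>"
  proof -
    have "y1 - y2 = \<sigma> * (2 * h)" by (simp add: y1_def y2_def algebra_simps)
    then show ?thesis using h by simp
  qed
  moreover have "{y. poly W y = 0} = {y1, y2}"
    using factor by auto
  ultimately show thesis
    using that[of y1 y2] unfolding zeros_eq by simp
qed

lemma zeros_zero_discriminant:
  assumes "b ^ 2 - 4 * c = 0"
  shows "\<exists>\<tau>. {t \<in> residue_disk r. F t = 0} = {\<tau>} \<and> zero_of_mult F \<tau> 2"
proof -
  have "0 ^ 2 = b ^ 2 - 4 * c" using assms by simp
  then obtain y1 y2 where y: "\<forall>y. poly W y = (y - y1) * (y - y2)" "y1 - y2 = 0"
    "{t \<in> residue_disk r. F t = 0} = {least_rep r + y1, least_rep r + y2}"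
    by (rule zeros_square_discriminant)
  have "zero_of_mult F (least_rep r + y1) 2"
    using y(2) by (intro zero_of_mult_double) (simp add: y(1) power2_eq_square)
  with y show ?thesis by auto
qed

lemma zeros_nonzero_square_discriminant:
  assumes "b ^ 2 - 4 * c \<noteq> 0" "s ^ 2 = to_fract (b ^ 2 - 4 * c)"
  shows "\<exists>\<tau> \<tau>'. \<tau> \<noteq> \<tau>' \<and> {t \<in> residue_disk r. F t = 0} = {\<tau>, \<tau>'} \<and>
    zero_of_mult F \<tau> 1 \<and> zero_of_mult F \<tau>' 1"
proof -
  \<comment> \<open>A square root of the discriminant in the fraction field is a root of X^2 -
    \<delta>, hence integral.\<close>
  have "s ^ 2 + to_fract 0 * s + to_fract (- (b ^ 2 - 4 * c)) = 0"
    using assms(2) by (simp only: to_fract_uminus) simp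
  then obtain \<sigma> where "\<sigma> ^ 2 + 0 * \<sigma> + - (b ^ 2 - 4 * c) = 0"
    by (rule padic_quadratic_integral)
  then have \<sigma>: "\<sigma> ^ 2 = b ^ 2 - 4 * c"
    by (simp only: mult_zero_left add_0_right add_eq_0_iff2 minus_minus)
  obtain y1 y2 where y: "\<forall>y. poly W y = (y - y1) * (y - y2)" "y1 - y2 = \<sigma>"
    "{t \<in> residue_disk r. F t = 0} = {least_rep r + y1, least_rep r + y2}"
    using \<sigma> by (rule zeros_square_discriminant)
  have "\<sigma> \<noteq> 0" using \<sigma> assms(1) by auto
  with y(2) have "y1 \<noteq> y2" by auto
  moreover have "zero_of_mult F (least_rep r + y1) 1"
    using \<open>y1 \<noteq> y2\<close> by (intro zero_of_mult_factored[of _ _ "y1 - y2"]) (simp_all add: y(1) algebra_simps)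
  moreover have "zero_of_mult F (least_rep r + y2) 1"
    using \<open>y1 \<noteq> y2\<close> by (intro zero_of_mult_factored[of _ _ "y2 - y1"]) (simp_all add: y(1) algebra_simps)
  ultimately show ?thesis
    unfolding y(3) by (intro exI[of _ "least_rep r + y1"] exI[of _ "least_rep r + y2"]) simp
qed

end

end

section \<open>Quadratic reduction of the trace function and assembly of the theorem\<close>

lemma padic_two_unit:
  assumes "CARD('p :: prime_card) \<ge> 5"
  shows "(2 :: 'p padic_int) dvd 1"
proof -
  have "\<not> CARD('p) dvd 2" using assms by (auto dest: dvd_imp_le)
  from padic_of_nat_unit[OF this] show ?thesis by simp
qed

text \<open>With h = 1/2 the constants p^m / m! for m = 0, 1, 2 are 1, p and p^2 h.\<close>

lemma sum_falling_poly_3: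
  assumes "CARD('p :: prime_card) \<ge> 5" "2 * h = 1"
  shows "(\<Sum>m<3. smult (\<tau> m * p_power_div_fact m) (falling_poly m (s :: 'p padic_int))) =
    [:\<tau> 0 + \<tau> 1 * padic_p * s + padic_p ^ 2 * (\<tau> 2 * h * (s * (s - 1))),
      \<tau> 1 * padic_p + padic_p ^ 2 * (\<tau> 2 * h * (2 * s - 1)), padic_p ^ 2 * (\<tau> 2 * h):]"
proof -
  let ?c = "p_power_div_fact :: nat \<Rightarrow> 'p padic_int"
  have "?c 0 = 1" "?c 1 = padic_p"
    using p_power_div_fact(1)[OF assms(1), of 0] p_power_div_fact(1)[OF assms(1), of 1] by simp_all
  moreover have "?c 2 = padic_p ^ 2 * h"
  proof -
    have "padic_p ^ 2 * h = (2 * h) * ?c 2"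
      by (simp add: p_power_div_fact(1)[OF assms(1), of 2])
    then show ?thesis using assms(2) by simp
  qed
  ultimately show ?thesis
    by (simp add: falling_poly_def eval_nat_numeral algebra_simps)
qed

lemma quadratic_reduction_binomial_series:
  fixes F :: "'p :: prime_card padic_int \<Rightarrow> 'p padic_int"
  assumes p5: "CARD('p) \<ge> 5"
    and F: "\<And>t. adic_sums padic_p (\<lambda>m. \<tau> m * (padic_p ^ m * padic_binom t m)) (F t)"
    and \<tau>: "\<tau> 0 = padic_p ^ 2 * T'" "\<tau> 1 = padic_p * B'" "padic_red (\<tau> 2) = \<Delta>" "\<Delta> \<noteq> 0"
    and Q: "Q = [:padic_red T', padic_red B':] + smult (\<Delta> / 2) ([:0, 1:] * [:-1, 1:])"
  shows "quadratic_reduction F Q (\<Delta> / 2)"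
proof
  show two: "(2 :: 'p padic_int) dvd 1" using p5 by (rule padic_two_unit)
  then have two': "(2 :: 'p mod_ring) \<noteq> 0"
    by (simp add: padic_unit_iff padic_red_numeral)
  then show "\<Delta> / 2 \<noteq> 0" using \<tau>(4) by simp
  have "coeff Q 2 = \<Delta> / 2" by (simp add: Q eval_nat_numeral)
  with \<open>\<Delta> / 2 \<noteq> 0\<close> show "Q \<noteq> 0" by auto
  fix s
  obtain h :: "'p padic_int" where h: "2 * h = 1" using two by (metis dvdE)
  have "2 * padic_red h = 1"
    using arg_cong[OF h, of padic_red] by (simp add: padic_red_mult padic_red_numeral padic_red_1)
  then have red_h: "padic_red h = 1 / 2" using two' by (simp add: field_simps)
  \<comment> \<open>p^2 R collects the terms m \<le> 2. Modulo p the coefficients of R are Q(s),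
    Q'(s) and \<Delta>/2.\<close>
  define R where "R = [:T' + B' * s + \<tau> 2 * h * (s * (s - 1)), B' + \<tau> 2 * h * (2 * s - 1), \<tau> 2 * h:]"
  have R: "(\<Sum>m<3. smult (\<tau> m * p_power_div_fact m) (falling_poly m s)) = smult (padic_p ^ 2) R"
    unfolding sum_falling_poly_3[OF p5 h] R_def \<tau>(1,2) by (simp add: power2_eq_square algebra_simps)
  obtain g where g: "restricted g" "\<And>y. F (s + y) = restricted_eval g y"
    "fps_const (padic_p ^ 3) dvd g - fps_of_poly (smult (padic_p ^ 2) R)"
    using binomial_series_expansion[OF p5 F, of s] unfolding R by blast
  have g_nth: "padic_p ^ 3 dvd fps_nth g n - padic_p ^ 2 * coeff R n" for n
    using fps_const_dvdD[OF g(3), of n] by simp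
  have p3: "(padic_p :: 'p padic_int) ^ 3 = padic_p ^ 2 * padic_p" by (simp add: eval_nat_numeral)
  have "padic_p ^ 2 dvd fps_nth g n" for n
  proof -
    have "padic_p ^ 2 dvd fps_nth g n - padic_p ^ 2 * coeff R n"
      using g_nth[of n] unfolding p3 by (rule dvd_mult_left)
    from dvd_add[OF this dvd_triv_left[of _ "coeff R n"]] show ?thesis by simp
  qed
  then have "fps_const (padic_p ^ 2) dvd g" unfolding fps_const_dvd_iff by blast
  then obtain H where H: "g = fps_const (padic_p ^ 2) * H" by (elim dvdE)
  have H_restr: "restricted H" using g(1) unfolding H by (rule restricted_div_p_power)
  have red: "padic_red (fps_nth H n) = padic_red (coeff R n)" for n
  proof -
    have "padic_p ^ 2 * padic_p dvd padic_p ^ 2 * (fps_nth H n - coeff R n)"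
      using g_nth[of n] unfolding H p3 by (simp add: right_diff_distrib)
    then show ?thesis unfolding padic_red_eq_iff by simp
  qed
  have "F (s + y) = padic_p ^ 2 * restricted_eval H y" for y
    unfolding g(2) H using H_restr by (simp add: restricted_eval_mult restricted_const restricted_eval_const del: fps_const_power)
  moreover have "padic_red (fps_nth H 0) = poly Q (padic_red s)"
    unfolding red R_def Q
    by (simp add: padic_red_add padic_red_mult padic_red_diff padic_red_1 red_h \<tau>(3) algebra_simps)
  moreover have "padic_red (fps_nth H 1) = poly (pderiv Q) (padic_red s)"
    unfolding red R_def Q using two'
    by (simp add: padic_red_add padic_red_mult padic_red_diff padic_red_1 padic_red_numeral red_h \<tau>(3)
        pderiv_add pderiv_smult pderiv_pCons field_simps)
  moreover have "padic_red (fps_nth H 2) = \<Delta> / 2"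
  proof -
    have "coeff R (Suc (Suc 0)) = \<tau> 2 * h" by (simp add: R_def)
    then have "coeff R 2 = \<tau> 2 * h" by (simp only: Suc_1[unfolded One_nat_def])
    then show ?thesis unfolding red by (simp add: padic_red_mult red_h \<tau>(3))
  qed
  moreover have "padic_red (fps_nth H n) = 0" if "n \<ge> 3" for n
    using that unfolding red R_def by (simp add: padic_red_0 coeff_eq_0)
  ultimately show "\<exists>H. restricted H \<and> (\<forall>y. F (s + y) = padic_p ^ 2 * restricted_eval H y) \<and>
      padic_red (fps_nth H 0) = poly Q (padic_red s) \<and>
      padic_red (fps_nth H 1) = poly (pderiv Q) (padic_red s) \<and>
      padic_red (fps_nth H 2) = \<Delta> / 2 \<and> (\<forall>n\<ge>3. padic_red (fps_nth H n) = 0)"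
    using H_restr by blast
qed

text \<open>Terms from m = 2 on carry p^m, and the term m = 1 carries p together with the factor p
  of \<tau> 1. So F is constant modulo p^2.\<close>

lemma binomial_series_mod_p_square:
  fixes F :: "'p :: prime_card padic_int \<Rightarrow> 'p padic_int"
  assumes F: "\<And>t. adic_sums padic_p (\<lambda>m. \<tau> m * (padic_p ^ m * padic_binom t m)) (F t)"
    and \<tau>1: "padic_p dvd \<tau> 1"
  shows "padic_p ^ 2 dvd F t - \<tau> 0"
proof -
  have "padic_p ^ 2 dvd (\<Sum>m<2. \<tau> m * (padic_p ^ m * padic_binom t m)) - F t"
    by (rule adic_sums_tail[OF F]) (simp add: dvd_mult dvd_mult2 le_imp_power_dvd)
  moreover have "padic_p ^ 2 dvd (\<Sum>m<2. \<tau> m * (padic_p ^ m * padic_binom t m)) - \<tau> 0"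
  proof -
    have "(\<Sum>m<2. \<tau> m * (padic_p ^ m * padic_binom t m)) - \<tau> 0 = \<tau> 1 * padic_p * padic_binom t 1"
      by (simp add: eval_nat_numeral padic_binom_def)
    then show ?thesis
      using mult_dvd_mono[OF \<tau>1 dvd_refl[of padic_p]] by (simp add: power2_eq_square dvd_mult2)
  qed
  ultimately show ?thesis by (rule dvd_diff_left_common)
qed

theorem theorem3p17:
  fixes \<iota> :: "'p :: prime_card padic_int \<Rightarrow> 'a :: comm_ring_1"
    and \<eta> \<gamma> U :: 'a
    and P a :: nat
    and \<omega> x :: "('a, 'p) mod_p"
    and p T B :: "'p padic_int"
    and F :: "'p padic_int \<Rightarrow> 'p padic_int"
    and \<Delta> :: "'p mod_ring"
    and Q :: "'p mod_ring poly"
  assumes "CARD('p) \<ge> 5"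
    and "p = of_nat CARD('p)"
    and "finite_etale 3 \<iota>"
    and "\<eta> dvd 1"
    and "P = mult_order (to_mod_p \<eta> :: ('a, 'p) mod_p)"
    and "\<eta> ^ P = 1 + of_nat CARD('p) * U"
    and "\<omega> = to_mod_p U"
    and "is_alg_basis mod_p_scalar 3 (\<lambda>i. \<omega> ^ i)"
    and "a < P"
    and "x = to_mod_p \<gamma> * to_mod_p \<eta> ^ a"
    and "T = alg_trace \<iota> 3 (\<gamma> * \<eta> ^ a)"
    and "F = (\<lambda>t. alg_trace \<iota> 3 (\<gamma> * \<eta> ^ a * adic_pow \<iota> (\<eta> ^ P) t))"
    and "x \<noteq> 0"
    and "alg_trace mod_p_scalar 3 x = 0"
    and "alg_trace mod_p_scalar 3 (x * \<omega>) = 0"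
    and "\<Delta> = alg_trace mod_p_scalar 3 (x * \<omega> ^ 2)"
    and "B = alg_trace \<iota> 3 (\<gamma> * \<eta> ^ a * U)"
    and "Q = [:padic_red (T div p ^ 2), padic_red (B div p):] +
             smult (\<Delta> / 2) ([:0, 1:] * [:-1, 1:])"
  shows "\<Delta> \<noteq> 0 \<and> p dvd T \<and>
    (padic_red (T div p) \<noteq> 0 \<longrightarrow> (\<forall>t. \<not> p ^ 2 dvd F t)) \<and>
    (padic_red (T div p) = 0 \<longrightarrow>
      p ^ 2 dvd T \<and> p dvd B \<and>
      (\<forall>t. p ^ 2 dvd F t \<and> padic_red (F t div p ^ 2) = poly Q (padic_red t)) \<and>
      (\<forall>\<rho>. \<forall>t \<in> residue_disk \<rho>. p ^ 3 dvd F t \<longleftrightarrow> poly Q \<rho> = 0) \<and>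
      (\<forall>r. order r Q = 1 \<longrightarrow>
        (\<exists>!\<tau>. \<tau> \<in> residue_disk r \<and> F \<tau> = 0) \<and>
        (\<forall>\<tau> \<in> residue_disk r. F \<tau> = 0 \<longrightarrow>
          (\<forall>t \<in> residue_disk r. padic_val (F t) = 2 + padic_val (t - \<tau>)))) \<and>
      (\<forall>r. order r Q = 2 \<longrightarrow>
        (\<exists>!H. restricted H \<and> (\<forall>y. F (least_rep r + y) = p ^ 2 * restricted_eval H y)) \<and>
        (\<forall>H. restricted H \<and> (\<forall>y. F (least_rep r + y) = p ^ 2 * restricted_eval H y) \<longrightarrow>
          (\<exists>!W. distinguished W \<and> degree W = 2 \<and>
             (\<exists>V. restricted_unit V \<and> H = fps_of_poly W * V)) \<and>
          (\<forall>W b c V. W = [:c, b, 1:] \<and> p dvd b \<and> p dvd c \<and>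
             restricted_unit V \<and> H = fps_of_poly W * V \<longrightarrow>
            (\<forall>z :: 'p padic_int fract. poly (map_poly to_fract W) z = 0 \<longrightarrow>
               (\<exists>y. p dvd y \<and> z = to_fract y)) \<and>
            bij_betw (\<lambda>t. to_fract (t - least_rep r))
              {t \<in> residue_disk r. F t = 0}
              {z :: 'p padic_int fract. poly (map_poly to_fract W) z = 0} \<and>
            (let \<delta> = b ^ 2 - 4 * c; Z = {t \<in> residue_disk r. F t = 0} in
              ((\<nexists>s. s ^ 2 = to_fract \<delta>) \<longrightarrow> Z = {}) \<and>
              (\<delta> = 0 \<longrightarrow> (\<exists>\<tau>. Z = {\<tau>} \<and> zero_of_mult F \<tau> 2)) \<and>
              (\<delta> \<noteq> 0 \<and> (\<exists>s. s ^ 2 = to_fract \<delta>) \<longrightarrow>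
                (\<exists>\<tau> \<tau>'. \<tau> \<noteq> \<tau>' \<and> Z = {\<tau>, \<tau>'} \<and>
                   zero_of_mult F \<tau> 1 \<and> zero_of_mult F \<tau>' 1))) \<and>
            (\<forall>k \<ge> 3. {t \<in> residue_disk r. p ^ k dvd F t} =
               {least_rep r + y | y. p dvd y \<and> p ^ (k - 2) dvd poly W y})))))"
proof -
  have \<iota>: "comm_ring_hom \<iota>" using assms(3) unfolding finite_etale_def by blast
  obtain b where b: "is_alg_basis \<iota> 3 b" using assms(3) unfolding finite_etale_def by blast
  note p = assms(2)
  define y where "y = \<gamma> * \<eta> ^ a"
  define \<tau> where "\<tau> m = alg_trace \<iota> 3 (y * U ^ m)" for m
  have T: "T = \<tau> 0" and B: "B = \<tau> 1"
    by (simp_all add: assms(11,17) \<tau>_def y_def)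
  have F: "adic_sums padic_p (\<lambda>m. \<tau> m * (padic_p ^ m * padic_binom t m)) (F t)" for t
    using adic_sums_trace_adic_pow[OF \<iota> b, of y U t] by (simp add: \<tau>_def y_def assms(6,12))
  \<comment> \<open>The cases m = 0, 1, 2 are the three residue traces: the first two give
    divisibility of T and B by p, the third is \<Delta>.\<close>
  have red: "padic_red (\<tau> m) = alg_trace mod_p_scalar 3 (x * \<omega> ^ m)" for m
    using alg_trace_to_mod_p[OF \<iota> b, of "y * U ^ m"]
    by (simp add: \<tau>_def y_def assms(7,10) to_mod_p_mult to_mod_p_power)
  have \<Delta>: "\<Delta> \<noteq> 0"
    using etale_trace_nondegenerate[OF assms(3,8,14,15)] assms(13,16) by auto
  have pT: "p dvd T" and pB: "p dvd B"
    using red[of 0] red[of 1] assms(14,15) by (simp_all add: T B p flip: padic_red_eq_0_iff)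
  have first: "\<not> p ^ 2 dvd F t" if "padic_red (T div p) \<noteq> 0" for t
  proof
    assume "p ^ 2 dvd F t"
    moreover have "p ^ 2 dvd F t - T"
      using binomial_series_mod_p_square[OF F, of t] pB by (simp add: T B p)
    ultimately have "p ^ 2 dvd F t - (F t - T)" by (rule dvd_diff)
    then have "p ^ 2 dvd T" by simp
    then obtain k where "T = p ^ 2 * k" by (elim dvdE)
    then have "T = p * (p * k)" by (simp add: power2_eq_square)
    then have "p dvd T div p" by (simp add: p)
    with that show False by (simp add: p padic_red_eq_0_iff)
  qed
  have second: "p ^ 2 dvd T" "quadratic_reduction F Q (\<Delta> / 2)" if "padic_red (T div p) = 0"
  proof -
    obtain T1 where T1: "T = p * T1" using pT by (elim dvdE)
    then have "padic_red T1 = 0" using that by (simp add: p)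
    then have "p dvd T1" by (simp add: p padic_red_eq_0_iff)
    then obtain T' where "T1 = p * T'" by (elim dvdE)
    then have T': "T = p ^ 2 * T'" by (simp add: T1 power2_eq_square)
    then show "p ^ 2 dvd T" by simp
    obtain B' where B': "B = p * B'" using pB by (elim dvdE)
    show "quadratic_reduction F Q (\<Delta> / 2)"
    proof (rule quadratic_reduction_binomial_series[OF assms(1) F])
      show "\<tau> 0 = padic_p ^ 2 * T'" "\<tau> 1 = padic_p * B'"
        using T' B' by (simp_all add: T B p)
      show "padic_red (\<tau> 2) = \<Delta>" by (simp add: red assms(16))
      show "\<Delta> \<noteq> 0" by (rule \<Delta>)
      show "Q = [:padic_red T', padic_red B':] + smult (\<Delta> / 2) ([:0, 1:] * [:-1, 1:])"
        unfolding assms(18) using T' B' by (simp add: p)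
    qed
  qed
  have third: "(\<forall>t. p ^ 2 dvd F t \<and> padic_red (F t div p ^ 2) = poly Q (padic_red t)) \<and>
      (\<forall>\<rho>. \<forall>t \<in> residue_disk \<rho>. p ^ 3 dvd F t \<longleftrightarrow> poly Q \<rho> = 0) \<and>
      (\<forall>r. order r Q = 1 \<longrightarrow>
        (\<exists>!\<tau>. \<tau> \<in> residue_disk r \<and> F \<tau> = 0) \<and>
        (\<forall>\<tau> \<in> residue_disk r. F \<tau> = 0 \<longrightarrow>
          (\<forall>t \<in> residue_disk r. padic_val (F t) = 2 + padic_val (t - \<tau>))))"
    if "padic_red (T div p) = 0"
  proof -
    interpret quadratic_reduction F Q "\<Delta> / 2" using that by (rule second)
    show ?thesis
      unfolding p using F_div_p_square p_cubed_dvd_F_iff simple_root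
      by (simp add: residue_disk_eq)
  qed
  have fourth: "(\<exists>!H. restricted H \<and> (\<forall>y. F (least_rep r + y) = p ^ 2 * restricted_eval H y)) \<and>
      (\<forall>H. restricted H \<and> (\<forall>y. F (least_rep r + y) = p ^ 2 * restricted_eval H y) \<longrightarrow>
        (\<exists>!W. distinguished W \<and> degree W = 2 \<and> (\<exists>V. restricted_unit V \<and> H = fps_of_poly W * V)))"
    if "padic_red (T div p) = 0" "order r Q = 2" for r
  proof -
    interpret quadratic_reduction F Q "\<Delta> / 2" using that(1) by (rule second)
    show ?thesis
      unfolding p using expansion_ex1[of "least_rep r"] double_root_weierstrass[OF that(2)] by blast
  qed
  have fifth: "(\<forall>z :: 'p padic_int fract. poly (map_poly to_fract W) z = 0 \<longrightarrow>
         (\<exists>y. p dvd y \<and> z = to_fract y)) \<and>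
      bij_betw (\<lambda>t. to_fract (t - least_rep r)) {t \<in> residue_disk r. F t = 0}
        {z :: 'p padic_int fract. poly (map_poly to_fract W) z = 0} \<and>
      (let \<delta> = b ^ 2 - 4 * c; Z = {t \<in> residue_disk r. F t = 0} in
        ((\<nexists>s. s ^ 2 = to_fract \<delta>) \<longrightarrow> Z = {}) \<and>
        (\<delta> = 0 \<longrightarrow> (\<exists>\<tau>. Z = {\<tau>} \<and> zero_of_mult F \<tau> 2)) \<and>
        (\<delta> \<noteq> 0 \<and> (\<exists>s. s ^ 2 = to_fract \<delta>) \<longrightarrow>
          (\<exists>\<tau> \<tau>'. \<tau> \<noteq> \<tau>' \<and> Z = {\<tau>, \<tau>'} \<and>
             zero_of_mult F \<tau> 1 \<and> zero_of_mult F \<tau>' 1))) \<and>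
      (\<forall>k \<ge> 3. {t \<in> residue_disk r. p ^ k dvd F t} =
         {least_rep r + y | y. p dvd y \<and> p ^ (k - 2) dvd poly W y})"
    if "padic_red (T div p) = 0"
      and H: "restricted H" "\<forall>y. F (least_rep r + y) = p ^ 2 * restricted_eval H y"
      and W: "W = [:c, b, 1:]" "p dvd b" "p dvd c"
      and V: "restricted_unit V" "H = fps_of_poly W * V" for r H W b c V
  proof -
    interpret quadratic_reduction F Q "\<Delta> / 2" using that(1) by (rule second)
    note HWV = H(1) H(2)[unfolded p, rule_format] W(1) W(2,3)[unfolded p] V
    show ?thesis
      unfolding p Let_def
    proof (intro conjI allI impI)
      show "\<exists>y. padic_p dvd y \<and> z = to_fract y" if "poly (map_poly to_fract W) z = 0" for z
        using that p_dvd_root[OF HWV] unfolding fract_root_iff[OF HWV] by blast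
    next
      show "{t \<in> residue_disk r. F t = 0} = {}" if "\<nexists>s. s ^ 2 = to_fract (b ^ 2 - 4 * c)"
        using that by (rule zeros_nonsquare_discriminant[OF HWV])
    next
      show "\<exists>\<tau> \<tau>'. \<tau> \<noteq> \<tau>' \<and> {t \<in> residue_disk r. F t = 0} = {\<tau>, \<tau>'} \<and>
          zero_of_mult F \<tau> 1 \<and> zero_of_mult F \<tau>' 1"
        if "b ^ 2 - 4 * c \<noteq> 0 \<and> (\<exists>s. s ^ 2 = to_fract (b ^ 2 - 4 * c))"
        using that zeros_nonzero_square_discriminant[OF HWV] by blast
    qed (rule zeros_bij_roots[OF HWV] zeros_zero_discriminant[OF HWV] p_power_dvd_F[OF HWV]; assumption)+
  qed
  show ?thesis
  proof (intro conjI impI, goal_cases)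
    \<comment> \<open>The ninth goal is the double root clause; it needs its nested quantifiers over
      H and W unfolded one at a time.\<close>
    case 9
    show ?case
    proof (intro allI impI, goal_cases)
      case (1 r)
      note r = fourth[OF 9 1]
      show ?case
      proof (rule conjI[OF r[THEN conjunct1]], intro allI impI, goal_cases)
        case (1 H)
        then have H: "restricted H" "\<forall>y. F (least_rep r + y) = p ^ 2 * restricted_eval H y"
          by blast+
        show ?case
        proof (rule conjI[OF r[THEN conjunct2, rule_format, OF 1]], intro allI impI, goal_cases)
          case (1 W b c V)
          then show ?case by (intro fifth[OF 9 H]) blast+
        qed
      qed
    qed
  qed (use \<Delta> pT pB first second(1) third in blast)+
qed

end
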